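(* Let $n>1$, let $\lambda\in X^+(n)$ and $\mu\in X^+(n-1)$ satisfy $\mu\longleftarrow\lambda$, and let $i,j$ be integers with $i\ge1$ and $1<j=i+1<n$. There is some $A\subset(i..j)$ such that $S_{i,j}(A)f_{\mu,\lambda}$ is a non-zero $U(n-1)$-high weight vector if and only if $j-1\in\mathfrak{B}^\mu(i,j)$ (i.e. $B^\mu(i,j-1)=0$), $j-1\notin\mathfrak{B}^{\mu,\lambda}(i,j)$ (i.e. $B^{\mu,\lambda}(i,j-1)\ne0$), and there exist a weakly decreasing injection from $\mathfrak{B}^{\mu,\lambda}(i,j-1)$ to $\mathfrak{C}^\mu(i,j-1)$ and a weakly increasing injection from $\mathfrak{B}^{\mu,\lambda}(i,j-1)$ to $\mathfrak{B}^\mu(i,j-1)$.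
   Context: Base field. $K$ is an algebraically closed field of characteristic $p>0$. Intervals. $[i..j]$, $(i..j]$, $[i..j)$, $(i..j)$ denote the sets of integers $a$ with $i\le a\le j$, $i<a\le j$, $i\le a<j$, $i<a<j$ respectively. For $A\subset\mathbb{Z}$ and $i\le j$, $A_{i..j}=\{a\in A: i<a<j\}$. Hyperalgebra. $U(m,\mathbb{Z})$ is the $\mathbb{Z}$-subalgebra of the universal enveloping algebra of $\mathfrak{gl}(m,\mathbb{C})$ generated by $1$, $X_{i,j}^{(r)}=X_{i,j}^r/r!$ ($i\ne j$, $r\ge1$) and $\binom{X_{i,i}}{r}$ ($r\ge1$), where $X_{i,j}$ is the matrix unit with $1$ in entry $(i,j)$; $U(m)=U(m,\mathbb{Z})\otimes_{\mathbb{Z}}K$. For $1\le i<j\le m$, $E^{(r)}_{i,j}$ and $F^{(r)}_{i,j}$ are the images in $U(m)$ of $X^{(r)}_{i,j}$ and $X^{(r)}_{j,i}$; $\binom{H_i}{r}$ is the image of $\binom{X_{i,i}}{r}$. The superscript is omitted if $r=1$, $H_i=\binom{H_i}{1}$, $E_i^{(r)}=E_{i,i+1}^{(r)}$, $F_{i,i}=1$. $U^0(m)$ is the subalgebra generated by $1$ and all $\binom{H_i}{r}$. $U(n-1)$ is viewed inside $U(n)$ via indices $\le n-1$. For $A\subset(i..j)$ with $A\cup\{i,j\}=\{a_0<\cdots<a_{k+1}\}$, put $F_{i,j}^A=F_{a_0,a_1}F_{a_1,a_2}\cdots F_{a_k,a_{k+1}}$ (so $F^\emptyset_{i,j}=F_{i,j}$).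 Weights. $X^+(m)$ is the set of integer sequences $\lambda_1\ge\cdots\ge\lambda_m$. A vector $v$ of a $U(m)$-module has weight $\lambda$ if $\binom{H_i}{r}v=\binom{\lambda_i}{r}v$ for $1\le i\le m$, $r\ge1$; it is a $U(m)$-high weight vector if moreover $E_i^{(r)}v=0$ for $1\le i<m$, $r\ge1$. Lowering operators. For $i<j$ and $A,B\subset(i..j)$ put $$\mathcal{H}_{i,j}(A,B)=\sum_{D\subset B\setminus A}(-1)^{|D|}\frac{\prod_{t\in A}(x_t-x_{D_i(t)})}{\prod_{t\in B}(x_t-x_{D_i(t)})},\qquad D_i(t)=\max\{s\in D\cup\{i\}:s<t\}.$$ It is known that this lies in $\mathbb{Z}[x_i,\ldots,x_{j-1}]$. $H_{i,j}(A,B)\in U^0(n)$ is its value at $x_k=k-H_k$, and $S_{i,j}(A)=\sum_{B\subset(i..j)}F_{i,j}^BH_{i,j}(A,B)$; also $S_{i,i}(\emptyset)=1$. Modules and vectors. For $\lambda\in X^+(n)$, $\nabla_n(\lambda)$ is the costandard (induced) module of $\mathrm{GL}(n)$ over $K$ with highest weight $\lambda$, viewed as a $U(n)$-module; $f_\lambda$ is a non-zero $U(n)$-high weight vector of $\nabla_n(\lambda)$ of weight $\lambda$, generating the simple submodule $L_n(\lambda)$. For $\mu\in X^+(n-1)$, $\mu\longleftarrow\lambda$ means $\lambda_i\ge\mu_i\ge\lambda_{i+1}$ for $1\le i<n$. In that case $f_{\mu,\lambda}$ denotes a non-zero $U(n-1)$-high weight vector of $\nabla_n(\lambda)$ of weight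 $\mu$ (it exists and is unique up to a scalar), normalized so that $E_1^{(a_1)}\cdots E_{n-1}^{(a_{n-1})}f_{\mu,\lambda}=f_\lambda$, where $a_i=\sum_{s=1}^i(\lambda_s-\mu_s)$. Residues. For $1\le i\le t<n$, $B^{\mu,\lambda}(i,t)\in\mathbb{Z}/p\mathbb{Z}$ is the class of $t-i+\mu_i-\lambda_{t+1}$; for $1\le i\le t<n-1$, $B^\mu(i,t)\in\mathbb{Z}/p\mathbb{Z}$ is the class of $t-i+\mu_i-\mu_{t+1}$. Further, $\mathfrak{C}^\mu(i,j)=\{a: i<a<j,\ a-i+\mu_i-\mu_a\equiv0\pmod p\}$, $\mathfrak{B}^{\mu,\lambda}(i,j)=\{a:i\le a<j,\ B^{\mu,\lambda}(i,a)=0\}$, $\mathfrak{B}^{\mu}(i,j)=\{a:i\le a<j,\ B^{\mu}(i,a)=0\}$ (each of these is empty when $j=i$). Maps. A map $\theta:A\to\mathbb{Z}$ with $A\subset\mathbb{Z}$ is weakly increasing (weakly decreasing) if $\theta(a)\ge a$ (resp. $\theta(a)\le a$) for all $a\in A$. *)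

theory Defs
  imports
    "HOL-Library.Poly_Mapping"
    "HOL-Computational_Algebra.Computational_Algebra"
    "HOL-Number_Theory.Cong"
    "HOL-Algebra.QuotRing"
    "HOL-Algebra.Generated_Rings"
    "Jordan_Normal_Form.Determinant"
begin

section \<open>The hyperalgebra of the general linear group\<close>

subsection \<open>The universal enveloping algebra of \<open>gl(m,C)\<close>\<close>

text \<open>Words in the letters \<open>(i,j)\<close>, written additively so that
  \<open>word \<Rightarrow>\<^sub>0 complex\<close> with its convolution product is the free associative algebra
  on the symbols \<open>X\<^sub>i\<^sub>j\<close>.\<close>

datatype word = Word (letters: "(nat \<times> nat) list")

instantiation word :: monoid_add
begin

definition zero_word :: word where "zero_word = Word []"

definition plus_word :: "word \<Rightarrow> word \<Rightarrow> word" where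
  "plus_word u v = Word (letters u @ letters v)"

instance
  by standard (simp_all add: zero_word_def plus_word_def)

end

type_synonym free = "word \<Rightarrow>\<^sub>0 complex"

definition Xvar :: "nat \<Rightarrow> nat \<Rightarrow> free" where
  "Xvar i j = Poly_Mapping.single (Word [(i, j)]) 1"

definition free_algebra :: "nat \<Rightarrow> free ring" where
  "free_algebra m =
     \<lparr>carrier = {f. \<forall>w \<in> Poly_Mapping.keys f. set (letters w) \<subseteq> {1..m} \<times> {1..m}},
      mult = (*), one = 1, zero = 0, add = (+)\<rparr>"

definition gl_relations :: "nat \<Rightarrow> free set" where
  "gl_relations m =
     {Xvar i j * Xvar k l - Xvar k l * Xvar i j
        - ((if j = k then Xvar i l else 0) - (if l = i then Xvar k j else 0)) | i j k l.
      i \<in> {1..m} \<and> j \<in> {1..m} \<and> k \<in> {1..m} \<and> l \<in> {1..m}}"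

definition gl_ideal :: "nat \<Rightarrow> free set" where
  "gl_ideal m = Idl\<^bsub>free_algebra m\<^esub> (gl_relations m)"

definition env_algebra :: "nat \<Rightarrow> free set ring" where
  "env_algebra m = free_algebra m Quot gl_ideal m"

subsection \<open>Kostant's integral form\<close>

definition div_power :: "nat \<Rightarrow> nat \<Rightarrow> nat \<Rightarrow> nat \<Rightarrow> free set" where
  "div_power m i j r =
     gl_ideal m +>\<^bsub>free_algebra m\<^esub> (Poly_Mapping.single 0 (1 / fact r) * Xvar i j ^ r)"

definition binom_diag :: "nat \<Rightarrow> nat \<Rightarrow> nat \<Rightarrow> free set" where
  "binom_diag m i r =
     gl_ideal m +>\<^bsub>free_algebra m\<^esub>
       (Poly_Mapping.single 0 (1 / fact r) * (\<Prod>k\<leftarrow>[0..<r]. Xvar i i - of_nat k))"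

definition kostant_form :: "nat \<Rightarrow> free set ring" where
  "kostant_form m = (env_algebra m)\<lparr>carrier := generate_ring (env_algebra m)
     ({div_power m i j r | i j r. i \<in> {1..m} \<and> j \<in> {1..m} \<and> i \<noteq> j \<and> 1 \<le> r} \<union>
      {binom_diag m i r | i r. i \<in> {1..m} \<and> 1 \<le> r})\<rparr>"

subsection \<open>Extension of scalars\<close>

text \<open>The tensor product \<open>R \<otimes>\<^sub>\<int> K\<close> of a ring \<open>R\<close> with \<open>K\<close> is realised as the monoid algebra over
  \<open>K\<close> of the multiplicative monoid of \<open>R\<close>, modulo the ideal which identifies the formal sum
  \<open>[a] + [b]\<close> with \<open>[a + b]\<close>; the class of \<open>c[a]\<close> is the pure tensor \<open>a \<otimes> c\<close>.\<close>

definition monoid_algebra :: "'a ring \<Rightarrow> ('a \<Rightarrow>\<^sub>0 'k::field) ring" where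
  "monoid_algebra R =
     \<lparr>carrier = {f. Poly_Mapping.keys f \<subseteq> carrier R},
      mult = (\<lambda>f g. \<Sum>a \<in> Poly_Mapping.keys f. \<Sum>b \<in> Poly_Mapping.keys g.
                Poly_Mapping.single (a \<otimes>\<^bsub>R\<^esub> b) (Poly_Mapping.lookup f a * Poly_Mapping.lookup g b)),
      one = Poly_Mapping.single \<one>\<^bsub>R\<^esub> 1, zero = 0, add = (+)\<rparr>"

definition tensor_ideal :: "'a ring \<Rightarrow> ('a \<Rightarrow>\<^sub>0 'k::field) set" where
  "tensor_ideal R = Idl\<^bsub>monoid_algebra R\<^esub>
     {Poly_Mapping.single (a \<oplus>\<^bsub>R\<^esub> b) 1 - (Poly_Mapping.single a 1 + Poly_Mapping.single b 1) | a b.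
      a \<in> carrier R \<and> b \<in> carrier R}"

definition tensor_field :: "'a ring \<Rightarrow> ('a \<Rightarrow>\<^sub>0 'k::field) set ring" where
  "tensor_field R = monoid_algebra R Quot tensor_ideal R"

definition pure_tensor :: "'a ring \<Rightarrow> 'a \<Rightarrow> 'k::field \<Rightarrow> ('a \<Rightarrow>\<^sub>0 'k) set" where
  "pure_tensor R a c = tensor_ideal R +>\<^bsub>monoid_algebra R\<^esub> Poly_Mapping.single a c"

type_synonym 'k hyper = "(free set \<Rightarrow>\<^sub>0 'k) set"

definition hyperalgebra :: "nat \<Rightarrow> 'k::field hyper ring" where
  "hyperalgebra m = tensor_field (kostant_form m)"

definition hscalar :: "nat \<Rightarrow> 'k::field \<Rightarrow> 'k hyper" where
  "hscalar m c = pure_tensor (kostant_form m) \<one>\<^bsub>kostant_form m\<^esub> c"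

definition hE :: "nat \<Rightarrow> nat \<Rightarrow> nat \<Rightarrow> nat \<Rightarrow> 'k::field hyper" where
  "hE m i j r = pure_tensor (kostant_form m) (div_power m i j r) 1"

definition hF :: "nat \<Rightarrow> nat \<Rightarrow> nat \<Rightarrow> nat \<Rightarrow> 'k::field hyper" where
  "hF m i j r = pure_tensor (kostant_form m) (div_power m j i r) 1"

definition hH :: "nat \<Rightarrow> nat \<Rightarrow> nat \<Rightarrow> 'k::field hyper" where
  "hH m i r = pure_tensor (kostant_form m) (binom_diag m i r) 1"

subsection \<open>Ring axioms\<close>

lemma free_algebra_ring: "ring (free_algebra m)"
proof -
  have mult: "set (letters w) \<subseteq> S" if "w \<in> Poly_Mapping.keys (f * g)" 
    "\<forall>w \<in> Poly_Mapping.keys f. set (letters w) \<subseteq> S" "\<forall>w \<in> Poly_Mapping.keys g. set (letters w) \<subseteq> S"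
    for f g :: free and w S
  proof -
    from that(1) keys_mult[of f g] obtain u v where "u \<in> Poly_Mapping.keys f" "v \<in> Poly_Mapping.keys g" "w = u + v" by blast
    then show ?thesis using that by (auto simp: plus_word_def)
  qed
  show ?thesis
  proof (rule ringI)
    show "abelian_group (free_algebra m)"
    proof (rule abelian_groupI)
      fix x y assume "x \<in> carrier (free_algebra m)" "y \<in> carrier (free_algebra m)"
      then show "x \<oplus>\<^bsub>free_algebra m\<^esub> y \<in> carrier (free_algebra m)"
        using Poly_Mapping.keys_add[of x y] unfolding free_algebra_def by auto
    next
      fix x assume "x \<in> carrier (free_algebra m)"
      then show "\<exists>y\<in>carrier (free_algebra m). y \<oplus>\<^bsub>free_algebra m\<^esub> x = \<zero>\<^bsub>free_algebra m\<^esub>"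
        by (intro bexI[of _ "-x"]) (auto simp: free_algebra_def)
    qed (auto simp: free_algebra_def add_ac)
    show "monoid (free_algebra m)"
      by (rule monoidI) (auto simp: free_algebra_def mult.assoc zero_word_def dest: mult[THEN subsetD, rotated 3])
  qed (auto simp: free_algebra_def algebra_simps)
qed

lemma monoid_algebra_ring:
  assumes "ring R"
  shows "ring (monoid_algebra R :: ('a \<Rightarrow>\<^sub>0 'k::field) ring)"
proof -
  interpret R: ring R by fact
  let ?M = "monoid_algebra R :: ('a \<Rightarrow>\<^sub>0 'k) ring"
  have m_sup: "f \<otimes>\<^bsub>?M\<^esub> g = (\<Sum>a\<in>A. \<Sum>b\<in>B. Poly_Mapping.single (a \<otimes>\<^bsub>R\<^esub> b) (Poly_Mapping.lookup f a * Poly_Mapping.lookup g b))"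
    if "finite A" "finite B" "Poly_Mapping.keys f \<subseteq> A" "Poly_Mapping.keys g \<subseteq> B" for f g A B
  proof -
    have "f \<otimes>\<^bsub>?M\<^esub> g = (\<Sum>a\<in>Poly_Mapping.keys f. \<Sum>b\<in>B. Poly_Mapping.single (a \<otimes>\<^bsub>R\<^esub> b) (Poly_Mapping.lookup f a * Poly_Mapping.lookup g b))"
      unfolding monoid_algebra_def using that
      by (simp, intro sum.cong refl sum.mono_neutral_left) (auto simp: not_in_keys_iff_lookup_eq_zero)
    also have "\<dots> = (\<Sum>a\<in>A. \<Sum>b\<in>B. Poly_Mapping.single (a \<otimes>\<^bsub>R\<^esub> b) (Poly_Mapping.lookup f a * Poly_Mapping.lookup g b))"
      using that by (intro sum.mono_neutral_left) (auto simp: in_keys_iff)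
    finally show ?thesis .
  qed
  have l_d: "(f + f') \<otimes>\<^bsub>?M\<^esub> g = f \<otimes>\<^bsub>?M\<^esub> g + f' \<otimes>\<^bsub>?M\<^esub> g" for f f' g
    using Poly_Mapping.keys_add[of f f']
    by (subst (1 2 3) m_sup[where A = "Poly_Mapping.keys f \<union> Poly_Mapping.keys f'" and B = "Poly_Mapping.keys g"])
       (auto simp: lookup_add distrib_right single_add sum.distrib)
  have r_d: "g \<otimes>\<^bsub>?M\<^esub> (f + f') = g \<otimes>\<^bsub>?M\<^esub> f + g \<otimes>\<^bsub>?M\<^esub> f'" for f f' g
    using Poly_Mapping.keys_add[of f f']
    by (subst (1 2 3) m_sup[where B = "Poly_Mapping.keys f \<union> Poly_Mapping.keys f'" and A = "Poly_Mapping.keys g"])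
       (auto simp: lookup_add distrib_left single_add sum.distrib)
  have l0: "0 \<otimes>\<^bsub>?M\<^esub> g = 0" and r0: "g \<otimes>\<^bsub>?M\<^esub> 0 = 0" for g
    by (auto simp: monoid_algebra_def)
  have l_s: "(\<Sum>a\<in>A. F a) \<otimes>\<^bsub>?M\<^esub> g = (\<Sum>a\<in>A. F a \<otimes>\<^bsub>?M\<^esub> g)" for A :: "'x set" and F g
    by (induction A rule: infinite_finite_induct) (auto simp: l0 l_d)
  have r_s: "g \<otimes>\<^bsub>?M\<^esub> (\<Sum>a\<in>A. F a) = (\<Sum>a\<in>A. g \<otimes>\<^bsub>?M\<^esub> F a)" for A :: "'x set" and F g
    by (induction A rule: infinite_finite_induct) (auto simp: r0 r_d)
  have ss: "Poly_Mapping.single a x \<otimes>\<^bsub>?M\<^esub> Poly_Mapping.single b y = Poly_Mapping.single (a \<otimes>\<^bsub>R\<^esub> b) (x * y)" for a b x y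
    by (subst m_sup[of "{a}" "{b}"]) auto
  have exp: "f = (\<Sum>a\<in>Poly_Mapping.keys f. Poly_Mapping.single a (Poly_Mapping.lookup f a))" for f :: "'a \<Rightarrow>\<^sub>0 'k"
    by (intro poly_mapping_eqI) (simp add: lookup_sum lookup_single when_def not_in_keys_iff_lookup_eq_zero)
  have cl: "f \<otimes>\<^bsub>?M\<^esub> g \<in> carrier ?M" if "f \<in> carrier ?M" "g \<in> carrier ?M" for f g
  proof -
    have "Poly_Mapping.keys (f \<otimes>\<^bsub>?M\<^esub> g) \<subseteq> carrier R"
      unfolding monoid_algebra_def using that
      by (auto simp: monoid_algebra_def dest!: subsetD[OF keys_sum] split: if_splits intro!: R.m_closed)
    then show ?thesis by (simp add: monoid_algebra_def)
  qed
  have as: "(f \<otimes>\<^bsub>?M\<^esub> g) \<otimes>\<^bsub>?M\<^esub> h = f \<otimes>\<^bsub>?M\<^esub> (g \<otimes>\<^bsub>?M\<^esub> h)"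
    if "f \<in> carrier ?M" "g \<in> carrier ?M" "h \<in> carrier ?M" for f g h
  proof -
    have kc: "a \<in> carrier R" if "a \<in> Poly_Mapping.keys x" "x \<in> carrier ?M" for a x
      using that by (auto simp: monoid_algebra_def)
    show ?thesis
      apply (subst (1 2) exp[of f], subst (1 2) exp[of g], subst (1 2) exp[of h])
      apply (simp only: l_s r_s ss)
      apply (intro sum.cong refl)
      using that by (simp add: kc R.m_assoc mult.assoc)
  qed
  show ?thesis
  proof (rule ringI)
    show "abelian_group ?M"
    proof (rule abelian_groupI)
      fix x y assume "x \<in> carrier ?M" "y \<in> carrier ?M"
      then show "x \<oplus>\<^bsub>?M\<^esub> y \<in> carrier ?M"
        using Poly_Mapping.keys_add[of x y] unfolding monoid_algebra_def by auto
    next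
      fix x assume "x \<in> carrier ?M"
      then show "\<exists>y\<in>carrier ?M. y \<oplus>\<^bsub>?M\<^esub> x = \<zero>\<^bsub>?M\<^esub>"
        by (intro bexI[of _ "-x"]) (auto simp: monoid_algebra_def)
    qed (auto simp: monoid_algebra_def add_ac)
    show "monoid ?M"
    proof (rule monoidI)
      fix x assume x: "x \<in> carrier ?M"
      have o: "\<one>\<^bsub>?M\<^esub> = Poly_Mapping.single \<one>\<^bsub>R\<^esub> 1" by (simp add: monoid_algebra_def)
      have kc: "a \<in> carrier R" if "a \<in> Poly_Mapping.keys x" for a
        using that x by (auto simp: monoid_algebra_def)
      show "\<one>\<^bsub>?M\<^esub> \<otimes>\<^bsub>?M\<^esub> x = x"
        unfolding o apply (subst (2) exp[of x], subst exp[of x])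
        apply (simp only: r_s ss) by (rule sum.cong) (auto simp: kc)
      show "x \<otimes>\<^bsub>?M\<^esub> \<one>\<^bsub>?M\<^esub> = x"
        unfolding o apply (subst (2) exp[of x], subst exp[of x])
        apply (simp only: l_s ss) by (rule sum.cong) (auto simp: kc)
    qed (use cl as in \<open>auto simp: monoid_algebra_def\<close>)
  qed (use l_d r_d in \<open>auto simp: monoid_algebra_def\<close>)
qed

lemma tensor_field_ring:
  assumes "ring R"
  shows "ring (tensor_field R :: ('a \<Rightarrow>\<^sub>0 'k::field) set ring)"
proof -
  interpret R: ring R by fact
  interpret M: ring "monoid_algebra R :: ('a \<Rightarrow>\<^sub>0 'k) ring" by (rule monoid_algebra_ring) fact
  have "ideal (tensor_ideal R) (monoid_algebra R :: ('a \<Rightarrow>\<^sub>0 'k) ring)"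
    unfolding tensor_ideal_def
  proof (rule M.genideal_ideal, safe)
    fix a b assume ab: "a \<in> carrier R" "b \<in> carrier R"
    have "Poly_Mapping.keys (Poly_Mapping.single (a \<oplus>\<^bsub>R\<^esub> b) 1 - (Poly_Mapping.single a 1 + Poly_Mapping.single b 1) :: 'a \<Rightarrow>\<^sub>0 'k) \<subseteq> {a \<oplus>\<^bsub>R\<^esub> b, a, b}"
      by (auto simp: in_keys_iff lookup_minus lookup_add lookup_single when_def split: if_splits)
    then show "Poly_Mapping.single (a \<oplus>\<^bsub>R\<^esub> b) 1 - (Poly_Mapping.single a 1 + Poly_Mapping.single b 1) \<in> carrier (monoid_algebra R :: ('a \<Rightarrow>\<^sub>0 'k) ring)"
      using ab by (auto simp: monoid_algebra_def)
  qed
  then show ?thesis unfolding tensor_field_def by (rule ideal.quotient_is_ring)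
qed

lemma free_carrier_simps:
  "Poly_Mapping.keys (Xvar i j) = {Word [(i,j)]}"
  by (simp add: Xvar_def)

lemma free_ops: "f \<otimes>\<^bsub>free_algebra m\<^esub> g = f * g" "f \<oplus>\<^bsub>free_algebra m\<^esub> g = f + g" "\<one>\<^bsub>free_algebra m\<^esub> = 1" "\<zero>\<^bsub>free_algebra m\<^esub> = 0"
  by (auto simp: free_algebra_def)

lemma X_in: "i \<in> {1..m} \<Longrightarrow> j \<in> {1..m} \<Longrightarrow> Xvar i j \<in> carrier (free_algebra m)"
  by (auto simp: free_algebra_def free_carrier_simps)

lemma fin_minus: "f \<in> carrier (free_algebra m) \<Longrightarrow> g \<in> carrier (free_algebra m) \<Longrightarrow> f - g \<in> carrier (free_algebra m)"
  using keys_diff[of f g] by (auto simp: free_algebra_def)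
lemma fin_mult: "f \<in> carrier (free_algebra m) \<Longrightarrow> g \<in> carrier (free_algebra m) \<Longrightarrow> f * g \<in> carrier (free_algebra m)"
  using monoid.m_closed[OF ring.is_monoid[OF free_algebra_ring[of m]], of f g] by (simp add: free_ops)
lemma fin0: "0 \<in> carrier (free_algebra m)" and fin_single0: "Poly_Mapping.single 0 c \<in> carrier (free_algebra m)"
  by (auto simp: free_algebra_def zero_word_def)
lemma fin_pow: "f \<in> carrier (free_algebra m) \<Longrightarrow> f ^ r \<in> carrier (free_algebra m)"
  by (induction r) (auto intro: fin_mult fin_single0[of 1, simplified])

lemma gl_ideal: "ideal (gl_ideal m) (free_algebra m)"
proof -
  have "gl_relations m \<subseteq> carrier (free_algebra m)"
    unfolding gl_relations_def
    by (safe, intro fin_minus fin_mult X_in) (auto intro: fin0 X_in fin_minus)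
  then show ?thesis unfolding gl_ideal_def by (rule ring.genideal_ideal[OF free_algebra_ring])
qed

lemma env_ring: "ring (env_algebra m)"
  unfolding env_algebra_def by (rule ideal.quotient_is_ring[OF gl_ideal])

lemma div_power_in: "i \<in> {1..m} \<Longrightarrow> j \<in> {1..m} \<Longrightarrow> div_power m i j r \<in> carrier (env_algebra m)"
  unfolding env_algebra_def FactRing_def div_power_def A_RCOSETS_def'
  by (auto intro!: exI fin_mult fin_pow X_in fin_single0)

lemma binom_diag_in: "i \<in> {1..m} \<Longrightarrow> binom_diag m i r \<in> carrier (env_algebra m)"
proof -
  assume i: "i \<in> {1..m}"
  have "prod_list (map (\<lambda>k. Xvar i i - of_nat k) ks) \<in> carrier (free_algebra m)" for ks
    by (induction ks) (use i in \<open>auto intro!: fin_mult fin_minus X_in fin_single0[of 1, simplified] fin_single0[of "of_nat _", simplified]\<close>)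
  then show ?thesis
    unfolding env_algebra_def FactRing_def binom_diag_def A_RCOSETS_def'
    by (auto intro!: exI fin_mult fin_single0)
qed

lemma kostant_ring: "ring (kostant_form m)"
  unfolding kostant_form_def
  by (rule ring.generate_ring_is_ring[OF env_ring]) (auto intro!: div_power_in binom_diag_in)

lemma hyper_ring: "ring (hyperalgebra m :: 'k::field hyper ring)"
  unfolding hyperalgebra_def by (rule tensor_field_ring[OF kostant_ring])

section \<open>Lowering operators\<close>

definition hprod :: "nat \<Rightarrow> 'k::field hyper list \<Rightarrow> 'k hyper" where
  "hprod m us = foldr (mult (hyperalgebra m)) us \<one>\<^bsub>hyperalgebra m\<^esub>"

definition hF_set :: "nat \<Rightarrow> nat \<Rightarrow> nat \<Rightarrow> nat set \<Rightarrow> 'k::field hyper" where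
  "hF_set m i j A =
     (let as = sorted_list_of_set (A \<union> {i, j})
      in hprod m (map (\<lambda>(a, b). hF m a b 1) (zip as (tl as))))"

text \<open>Integer polynomials in the variables \<open>x\<^sub>k\<close>, \<open>k :: nat\<close>, and rational functions.\<close>

type_synonym zpoly = "(nat \<Rightarrow>\<^sub>0 nat) \<Rightarrow>\<^sub>0 int"

definition xvar :: "nat \<Rightarrow> zpoly fract" where
  "xvar k = Fract (Poly_Mapping.single (Poly_Mapping.single k 1) 1) 1"

definition pred_in :: "nat \<Rightarrow> nat set \<Rightarrow> nat \<Rightarrow> nat" where
  "pred_in i D t = Max {s \<in> D \<union> {i}. s < t}"

definition calH :: "nat \<Rightarrow> nat set \<Rightarrow> nat set \<Rightarrow> zpoly fract" where
  "calH i A B =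
     (\<Sum>D \<in> Pow (B - A). (- 1) ^ card D *
        ((\<Prod>t\<in>A. xvar t - xvar (pred_in i D t)) / (\<Prod>t\<in>B. xvar t - xvar (pred_in i D t))))"

definition calH_poly :: "nat \<Rightarrow> nat set \<Rightarrow> nat set \<Rightarrow> zpoly" where
  "calH_poly i A B = (THE P. Fract P 1 = calH i A B)"

text \<open>Evaluation at \<open>x\<^sub>k = k - H\<^sub>k\<close>; the \<open>H\<^sub>k\<close> commute, so the (increasing) order of the
  factors of each monomial is immaterial.\<close>

definition eval_H :: "nat \<Rightarrow> zpoly \<Rightarrow> 'k::field hyper" where
  "eval_H m P = finsum (hyperalgebra m)
     (\<lambda>e. [Poly_Mapping.lookup P e] \<cdot>\<^bsub>hyperalgebra m\<^esub>
        hprod m (map (\<lambda>k. ([k] \<cdot>\<^bsub>hyperalgebra m\<^esub> \<one>\<^bsub>hyperalgebra m\<^esub> \<ominus>\<^bsub>hyperalgebra m\<^esub> hH m k 1)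
                             [^]\<^bsub>hyperalgebra m\<^esub> Poly_Mapping.lookup e k)
                  (sorted_list_of_set (Poly_Mapping.keys e))))
     (Poly_Mapping.keys P)"

definition lowering_op :: "nat \<Rightarrow> nat \<Rightarrow> nat \<Rightarrow> nat set \<Rightarrow> 'k::field hyper" where
  "lowering_op m i j A =
     (if i = j then \<one>\<^bsub>hyperalgebra m\<^esub>
      else finsum (hyperalgebra m)
        (\<lambda>B. hF_set m i j B \<otimes>\<^bsub>hyperalgebra m\<^esub> eval_H m (calH_poly i A B)) (Pow {i<..<j}))"

section \<open>Modules\<close>

text \<open>\<open>V\<close> is a \<open>K\<close>-space of \<open>K\<close>-valued functions, and \<open>act\<close> makes it a unital left
  module over the \<open>K\<close>-algebra \<open>hyperalgebra m\<close>.\<close>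

definition hyper_module ::
  "nat \<Rightarrow> ('x \<Rightarrow> 'k::field) set \<Rightarrow> ('k hyper \<Rightarrow> ('x \<Rightarrow> 'k) \<Rightarrow> ('x \<Rightarrow> 'k)) \<Rightarrow> bool" where
  "hyper_module m V act \<longleftrightarrow>
     (\<lambda>_. 0) \<in> V \<and>
     (\<forall>v\<in>V. \<forall>w\<in>V. \<forall>c. (\<lambda>x. v x + c * w x) \<in> V) \<and>
     (\<forall>u\<in>carrier (hyperalgebra m). \<forall>v\<in>V. act u v \<in> V) \<and>
     (\<forall>u\<in>carrier (hyperalgebra m). \<forall>v\<in>V. \<forall>w\<in>V. \<forall>c.
        act u (\<lambda>x. v x + c * w x) = (\<lambda>x. act u v x + c * act u w x)) \<and>
     (\<forall>u\<in>carrier (hyperalgebra m). \<forall>u'\<in>carrier (hyperalgebra m). \<forall>v\<in>V.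
        act (u \<oplus>\<^bsub>hyperalgebra m\<^esub> u') v = (\<lambda>x. act u v x + act u' v x) \<and>
        act (u \<otimes>\<^bsub>hyperalgebra m\<^esub> u') v = act u (act u' v)) \<and>
     (\<forall>c. \<forall>v\<in>V. act (hscalar m c) v = (\<lambda>x. c * v x))"

text \<open>This is \<open>gbinomial\<close> at type \<open>int\<close>, whose sort constraint excludes the integers; the
  division is exact.\<close>

definition int_binom :: "int \<Rightarrow> nat \<Rightarrow> int" where
  "int_binom a r = (\<Prod>k=0..<r. a - int k) div fact r"

text \<open>In the following two definitions a \<open>U(n)\<close>-module is regarded as a \<open>U(m)\<close>-module,
  \<open>m \<le> n\<close>, through the inclusion of \<open>U(m)\<close> in \<open>U(n)\<close> given by the indices up to \<open>m\<close>.\<close>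

definition has_weight ::
  "nat \<Rightarrow> nat \<Rightarrow> ('k::field hyper \<Rightarrow> ('x \<Rightarrow> 'k) \<Rightarrow> ('x \<Rightarrow> 'k)) \<Rightarrow> (nat \<Rightarrow> int) \<Rightarrow> ('x \<Rightarrow> 'k) \<Rightarrow> bool" where
  "has_weight n m act \<nu> v \<longleftrightarrow>
     (\<forall>i\<in>{1..m}. \<forall>r\<ge>1. act (hH n i r) v = (\<lambda>x. of_int (int_binom (\<nu> i) r) * v x))"

definition high_weight_vector ::
  "nat \<Rightarrow> nat \<Rightarrow> ('k::field hyper \<Rightarrow> ('x \<Rightarrow> 'k) \<Rightarrow> ('x \<Rightarrow> 'k)) \<Rightarrow> (nat \<Rightarrow> int) \<Rightarrow> ('x \<Rightarrow> 'k) \<Rightarrow> bool" where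
  "high_weight_vector n m act \<nu> v \<longleftrightarrow>
     has_weight n m act \<nu> v \<and> (\<forall>i\<in>{1..<m}. \<forall>r\<ge>1. act (hE n i (Suc i) r) v = (\<lambda>_. 0))"

section \<open>Costandard modules\<close>

definition GL :: "nat \<Rightarrow> 'k::field mat set" where
  "GL n = {g \<in> carrier_mat n n. det g \<noteq> 0}"

text \<open>Over an algebraically closed field a regular function on the group is determined by its
  values at rational points; the coordinate ring is generated by the matrix entries and the
  inverse of the determinant.\<close>

inductive_set regular_expr :: "nat \<Rightarrow> ('k::field mat \<Rightarrow> 'k) set" for n where
  const: "(\<lambda>_. c) \<in> regular_expr n"
| entry: "i < n \<Longrightarrow> j < n \<Longrightarrow> (\<lambda>g. g $$ (i, j)) \<in> regular_expr n"
| inv_det: "(\<lambda>g. inverse (det g)) \<in> regular_expr n"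
| add: "f \<in> regular_expr n \<Longrightarrow> h \<in> regular_expr n \<Longrightarrow> (\<lambda>g. f g + h g) \<in> regular_expr n"
| mult: "f \<in> regular_expr n \<Longrightarrow> h \<in> regular_expr n \<Longrightarrow> (\<lambda>g. f g * h g) \<in> regular_expr n"

text \<open>Functions on the group are represented by functions vanishing off it.\<close>

definition coordinate_ring :: "nat \<Rightarrow> ('k::field mat \<Rightarrow> 'k) set" where
  "coordinate_ring n = {f. (\<forall>g. g \<notin> GL n \<longrightarrow> f g = 0) \<and> (\<exists>h \<in> regular_expr n. \<forall>g \<in> GL n. f g = h g)}"

definition lower_borel :: "nat \<Rightarrow> 'k::field mat set" where
  "lower_borel n = {b \<in> GL n. \<forall>i<n. \<forall>j<n. i < j \<longrightarrow> b $$ (i, j) = 0}"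

text \<open>Weights are indexed from 1 and matrix entries from 0.\<close>

definition borel_char :: "nat \<Rightarrow> (nat \<Rightarrow> int) \<Rightarrow> 'k::field mat \<Rightarrow> 'k" where
  "borel_char n lam b = (\<Prod>i<n. (b $$ (i, i)) powi lam (Suc i))"

text \<open>The module induced from the lower triangular subgroup; the group acts on it by right
  translation, \<open>(h f)(g) = f (g h)\<close>. With respect to the upper triangular subgroup its highest
  weight is \<open>lam\<close>.\<close>

definition costandard :: "nat \<Rightarrow> (nat \<Rightarrow> int) \<Rightarrow> ('k::field mat \<Rightarrow> 'k) set" where
  "costandard n lam = {f \<in> coordinate_ring n.
     \<forall>b \<in> lower_borel n. \<forall>g \<in> GL n. f (b * g) = borel_char n lam b * f g}"

text \<open>The matrix \<open>1 + t X\<^sub>i\<^sub>j\<close>.\<close>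

definition elem_mat :: "nat \<Rightarrow> nat \<Rightarrow> nat \<Rightarrow> 'k::field \<Rightarrow> 'k mat" where
  "elem_mat n i j t = mat n n (\<lambda>(a, b). (if a = b then 1 else 0) + (if Suc a = i \<and> Suc b = j then t else 0))"

text \<open>The coefficient of \<open>t\<^sup>r\<close> in the expansion at \<open>t = 0\<close> of a rational function with no pole
  other than \<open>t = -1\<close>.\<close>

definition expansion_coeff :: "('k::field \<Rightarrow> 'k) \<Rightarrow> nat \<Rightarrow> 'k" where
  "expansion_coeff \<phi> r = (THE c. \<exists>Q k. (\<forall>t. t \<noteq> - 1 \<longrightarrow> \<phi> t * (1 + t) ^ k = poly Q t) \<and>
     c = fps_nth (fps_of_poly Q / (1 + fps_X) ^ k) r)"

text \<open>The identification of \<open>U(n)\<close> with the algebra of distributions on the group sends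
  \<open>X\<^sub>i\<^sub>j\<^sup>(\<^sup>r\<^sup>)\<close> (for \<open>i \<noteq> j\<close>) and the \<open>r\<close>-th binomial coefficient of \<open>H\<^sub>i\<close> (for \<open>i = j\<close>) to
  the functional taking \<open>f\<close> to the coefficient of \<open>t\<^sup>r\<close> in \<open>f (1 + t X\<^sub>i\<^sub>j)\<close>. These elements
  generate \<open>U(n)\<close>, so the conditions below determine the action on the induced module.\<close>

definition costandard_action ::
  "nat \<Rightarrow> (nat \<Rightarrow> int) \<Rightarrow> ('k::field hyper \<Rightarrow> ('k mat \<Rightarrow> 'k) \<Rightarrow> ('k mat \<Rightarrow> 'k)) \<Rightarrow> bool" where
  "costandard_action n lam act \<longleftrightarrow>
     hyper_module n (costandard n lam) act \<and>
     (\<forall>f \<in> costandard n lam. \<forall>g \<in> GL n. \<forall>i\<in>{1..n}. \<forall>r\<ge>1.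
        (\<forall>j\<in>{1..n}. i < j \<longrightarrow>
          act (hE n i j r) f g = expansion_coeff (\<lambda>t. f (g * elem_mat n i j t)) r \<and>
          act (hF n i j r) f g = expansion_coeff (\<lambda>t. f (g * elem_mat n j i t)) r) \<and>
        act (hH n i r) f g = expansion_coeff (\<lambda>t. f (g * elem_mat n i i t)) r)"

section \<open>Weights, branching and residues\<close>

definition dominant :: "nat \<Rightarrow> (nat \<Rightarrow> int) \<Rightarrow> bool" where
  "dominant m lam \<longleftrightarrow> (\<forall>i\<in>{1..<m}. lam (Suc i) \<le> lam i)"

definition branches :: "nat \<Rightarrow> (nat \<Rightarrow> int) \<Rightarrow> (nat \<Rightarrow> int) \<Rightarrow> bool" where
  "branches n mu lam \<longleftrightarrow> (\<forall>i\<in>{1..<n}. lam (Suc i) \<le> mu i \<and> mu i \<le> lam i)"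

text \<open>A primitive vector \<open>v\<close> for \<open>U(n-1)\<close> of weight \<open>mu\<close>, normalised against the highest
  weight vector \<open>w\<close>.\<close>

definition branching_vector ::
  "nat \<Rightarrow> (nat \<Rightarrow> int) \<Rightarrow> (nat \<Rightarrow> int) \<Rightarrow> ('k::field hyper \<Rightarrow> ('k mat \<Rightarrow> 'k) \<Rightarrow> ('k mat \<Rightarrow> 'k)) \<Rightarrow>
   ('k mat \<Rightarrow> 'k) \<Rightarrow> ('k mat \<Rightarrow> 'k) \<Rightarrow> bool" where
  "branching_vector n lam mu act w v \<longleftrightarrow>
     v \<in> costandard n lam \<and> v \<noteq> (\<lambda>_. 0) \<and> high_weight_vector n (n - 1) act mu v \<and>
     act (hprod n (map (\<lambda>i. hE n i (Suc i) (nat (\<Sum>s=1..i. lam s - mu s))) [1..<n])) v = w"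

text \<open>Residue classes modulo \<open>p\<close> are represented by their canonical representatives.\<close>

definition resB2 :: "nat \<Rightarrow> (nat \<Rightarrow> int) \<Rightarrow> (nat \<Rightarrow> int) \<Rightarrow> nat \<Rightarrow> nat \<Rightarrow> int" where
  "resB2 p mu lam i t = (int t - int i + mu i - lam (Suc t)) mod int p"

definition resB1 :: "nat \<Rightarrow> (nat \<Rightarrow> int) \<Rightarrow> nat \<Rightarrow> nat \<Rightarrow> int" where
  "resB1 p mu i t = (int t - int i + mu i - mu (Suc t)) mod int p"

definition frakC :: "nat \<Rightarrow> (nat \<Rightarrow> int) \<Rightarrow> nat \<Rightarrow> nat \<Rightarrow> nat set" where
  "frakC p mu i j = {a \<in> {i<..<j}. [int a - int i + mu i - mu a = 0] (mod int p)}"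

definition frakB2 :: "nat \<Rightarrow> (nat \<Rightarrow> int) \<Rightarrow> (nat \<Rightarrow> int) \<Rightarrow> nat \<Rightarrow> nat \<Rightarrow> nat set" where
  "frakB2 p mu lam i j = {a \<in> {i..<j}. resB2 p mu lam i a = 0}"

definition frakB1 :: "nat \<Rightarrow> (nat \<Rightarrow> int) \<Rightarrow> nat \<Rightarrow> nat \<Rightarrow> nat set" where
  "frakB1 p mu i j = {a \<in> {i..<j}. resB1 p mu i a = 0}"

definition weakly_increasing_on :: "nat set \<Rightarrow> (nat \<Rightarrow> nat) \<Rightarrow> bool" where
  "weakly_increasing_on A \<theta> \<longleftrightarrow> (\<forall>a\<in>A. a \<le> \<theta> a)"

definition weakly_decreasing_on :: "nat set \<Rightarrow> (nat \<Rightarrow> nat) \<Rightarrow> bool" where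
  "weakly_decreasing_on A \<theta> \<longleftrightarrow> (\<forall>a\<in>A. \<theta> a \<le> a)"

end

theory Submission
  imports Defs
begin

text \<open>
  Since \<open>j = i + 1\<close>, the interval \<open>(i..j)\<close> is empty, so \<open>A\<close> is empty and the lowering operator is
  \<open>F\<^sub>i\<close> itself (lemma \<open>lowering_op_Suc\<close>); the two injections have empty domain. What remains is that
  \<open>u = F\<^sub>i f\<close>, for \<open>f\<close> a non-zero \<open>U(n-1)\<close>-high weight vector of weight \<open>\<mu>\<close>, is a non-zero high weight
  vector exactly if \<open>\<mu>\<^sub>i - \<mu>\<^sub>i\<^sub>+\<^sub>1 = 0\<close> and \<open>\<lambda>\<^sub>i\<^sub>+\<^sub>1 - \<mu>\<^sub>i\<^sub>+\<^sub>1 \<noteq> 0\<close> in \<open>K\<close>; given the first equation the second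
  condition reads \<open>\<mu>\<^sub>i - \<lambda>\<^sub>i\<^sub>+\<^sub>1 \<noteq> 0\<close>.

  The argument takes place in the group and not in the hyperalgebra. Vectors of the costandard module
  are functions on \<open>GL(n)\<close>, and the divided powers of a root vector give the Taylor coefficients of
  \<open>t \<mapsto> f (g (1 + t X))\<close>. Hence \<open>f\<close> is a high weight vector for \<open>U(n-1)\<close> exactly if it is invariant
  under right translation by the simple root subgroups of \<open>GL(n-1)\<close> and an eigenvector of its diagonal
  torus (\<open>high_weight_iff_invariant\<close>). Together with the equivariance under the lower triangular
  subgroup on the left, this determines \<open>f\<close> by a single value: Gaussian elimination with a density
  argument reduces to the unitriangular matrices, the invariance reduces to the matrices \<open>1 + c\<close>
  with \<open>c\<close> supported above the diagonal in the last column, and rescaling by the torus reduces to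
  the case where the entries of \<open>c\<close> are all \<open>1\<close>. So \<open>f\<close> is zero if its value at this point is zero
  (\<open>vanishes_if_at_ones\<close>).

  Let \<open>x(t)\<close> and \<open>y(s)\<close> be the root subgroups of \<open>E\<^sub>i\<close> and \<open>F\<^sub>i\<close>; then \<open>u(g)\<close> is the coefficient of \<open>s\<close>
  in \<open>f (g y(s))\<close>. Factorising \<open>x(t) y(s)\<close> in \<open>SL(2)\<close> as lower times diagonal times upper gives
  \<open>u (g x(t)) = u(g) + (\<mu>\<^sub>i - \<mu>\<^sub>i\<^sub>+\<^sub>1) t f(g)\<close>, while \<open>u\<close> is invariant under the other simple root subgroups
  (\<open>lowering_translate_simple_root\<close>). This yields the first condition. Moving \<open>y(s)\<close> to the left past
  the distinguished point rescales one entry of the last column by \<open>1 - s\<close>, so the value of \<open>u\<close> there is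
  \<open>-(\<lambda>\<^sub>i\<^sub>+\<^sub>1 - \<mu>\<^sub>i\<^sub>+\<^sub>1)\<close> times that of \<open>f\<close> (\<open>lowering_at_ones\<close>), which yields the second.
\<close>

section \<open>Expansions of rational functions in one variable\<close>

text \<open>If the field were finite, adding \<open>1\<close> to the product of all \<open>X - a\<close> would give a polynomial without
  a root.\<close>

lemma infinite_UNIV_alg_closed: "infinite (UNIV :: 'k::alg_closed_field set)"
proof
  assume fin: "finite (UNIV :: 'k set)"
  define P :: "'k poly" where "P = (\<Prod>a\<in>UNIV. [:-a, 1:])"
  have deg: "degree P = card (UNIV :: 'k set)"
    unfolding P_def by (subst degree_prod_sum_eq) auto
  have "card (UNIV :: 'k set) > 0" using fin by (simp add: card_gt_0_iff)
  then have "degree (P + 1) > 0" using deg degree_add_eq_left[of 1 P] by simp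
  then obtain x where "poly (P + 1) x = 0" using alg_closed_imp_poly_has_root by blast
  moreover have "poly P x = 0"
    unfolding P_def poly_prod by (rule prod_zero) (use fin in auto)
  ultimately show False by simp
qed

lemma poly_eq_0_cofinite:
  fixes Q C :: "'k::alg_closed_field poly"
  assumes "C \<noteq> 0" and "finite S" and "\<And>t. t \<notin> S \<Longrightarrow> poly C t \<noteq> 0 \<Longrightarrow> poly Q t = 0"
  shows "Q = 0"
proof (rule ccontr)
  assume "Q \<noteq> 0"
  then have "finite (S \<union> {t. poly C t = 0} \<union> {t. poly Q t = 0})"
    using assms poly_roots_finite by blast
  moreover have "S \<union> {t. poly C t = 0} \<union> {t. poly Q t = 0} = UNIV" using assms(3) by blast
  ultimately show False using infinite_UNIV_alg_closed by metis
qed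

text \<open>The Taylor expansion at \<open>0\<close> of a function that agrees with the rational function \<open>Q / R\<close> wherever \<open>R\<close>
  does not vanish. Tolerating exceptional points allows identities of rational functions to be used
  without tracking where their denominators vanish.\<close>

definition has_expansion :: "('k::field \<Rightarrow> 'k) \<Rightarrow> 'k fps \<Rightarrow> bool" where
  "has_expansion \<phi> F \<longleftrightarrow> (\<exists>Q R. poly R 0 \<noteq> 0 \<and> (\<forall>s. poly R s \<noteq> 0 \<longrightarrow> \<phi> s * poly R s = poly Q s) \<and>
     F * fps_of_poly R = fps_of_poly Q)"

lemma has_expansionI:
  assumes "poly R 0 \<noteq> 0" "\<And>s. poly R s \<noteq> 0 \<Longrightarrow> \<phi> s * poly R s = poly Q s"
    "F * fps_of_poly R = fps_of_poly Q"
  shows "has_expansion \<phi> F"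
  using assms unfolding has_expansion_def by blast

lemma has_expansion_unique:
  fixes \<phi> :: "'k::alg_closed_field \<Rightarrow> 'k"
  assumes "has_expansion \<phi> F" and "has_expansion \<phi> G"
  shows "F = G"
proof -
  obtain Q R where 1: "poly R 0 \<noteq> 0" "\<And>s. poly R s \<noteq> 0 \<Longrightarrow> \<phi> s * poly R s = poly Q s"
    "F * fps_of_poly R = fps_of_poly Q" using assms(1) unfolding has_expansion_def by blast
  obtain Q' R' where 2: "poly R' 0 \<noteq> 0" "\<And>s. poly R' s \<noteq> 0 \<Longrightarrow> \<phi> s * poly R' s = poly Q' s"
    "G * fps_of_poly R' = fps_of_poly Q'" using assms(2) unfolding has_expansion_def by blast
  have R: "R \<noteq> 0" "R' \<noteq> 0" using 1(1) 2(1) by auto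
  have "Q * R' - Q' * R = 0"
  proof (rule poly_eq_0_cofinite[of "R * R'" "{}"])
    fix t assume "poly (R * R') t \<noteq> 0"
    then have "poly Q t = \<phi> t * poly R t" "poly Q' t = \<phi> t * poly R' t" using 1(2) 2(2) by auto
    then show "poly (Q * R' - Q' * R) t = 0" by simp
  qed (use R in auto)
  then have "fps_of_poly Q * fps_of_poly R' = fps_of_poly Q' * fps_of_poly R"
    by (simp flip: fps_of_poly_mult)
  then have "(F - G) * (fps_of_poly R * fps_of_poly R') = 0"
    by (simp add: algebra_simps flip: 1(3) 2(3))
  then show ?thesis using R by simp
qed

lemma has_expansion_cong:
  assumes "has_expansion \<phi> F" and "poly C 0 \<noteq> 0" and "\<And>s. poly C s \<noteq> 0 \<Longrightarrow> \<phi> s = \<psi> s"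
  shows "has_expansion \<psi> F"
proof -
  obtain Q R where 1: "poly R 0 \<noteq> 0" "\<And>s. poly R s \<noteq> 0 \<Longrightarrow> \<phi> s * poly R s = poly Q s"
    "F * fps_of_poly R = fps_of_poly Q" using assms(1) unfolding has_expansion_def by blast
  show ?thesis
  proof (rule has_expansionI[of "R * C" _ "Q * C"])
    fix s assume "poly (R * C) s \<noteq> 0"
    then have "\<phi> s * poly R s = poly Q s" "\<phi> s = \<psi> s" using 1(2)[of s] assms(3)[of s] by auto
    then show "\<psi> s * poly (R * C) s = poly (Q * C) s" by (metis poly_mult mult.assoc)
  qed (use 1(1) assms(2) in \<open>simp_all add: fps_of_poly_mult mult.assoc flip: 1(3)\<close>)
qed

lemma has_expansion_nth_0: "has_expansion \<phi> F \<Longrightarrow> fps_nth F 0 = \<phi> 0"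
proof -
  assume "has_expansion \<phi> F"
  then obtain Q R where 1: "poly R 0 \<noteq> 0" "\<And>s. poly R s \<noteq> 0 \<Longrightarrow> \<phi> s * poly R s = poly Q s"
    "F * fps_of_poly R = fps_of_poly Q" unfolding has_expansion_def by blast
  have "fps_nth F 0 * poly R 0 = poly Q 0"
    using arg_cong[OF 1(3), of "\<lambda>f. fps_nth f 0"] by (simp add: poly_0_coeff_0)
  then show ?thesis using 1(1) 1(2)[of 0] by (metis mult_right_cancel)
qed

lemma has_expansion_poly: "has_expansion (poly P) (fps_of_poly P)"
  by (rule has_expansionI[of 1 _ P]) auto

lemma has_expansion_const: "has_expansion (\<lambda>_. c) (fps_const c)"
proof -
  have "poly [:c:] = (\<lambda>_. c)" by auto
  then show ?thesis using has_expansion_poly[of "[:c:]"] by (simp add: fps_of_poly_const)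
qed

lemma has_expansion_add:
  assumes "has_expansion \<phi> F" and "has_expansion \<psi> G"
  shows "has_expansion (\<lambda>s. \<phi> s + \<psi> s) (F + G)"
proof -
  obtain Q R where 1: "poly R 0 \<noteq> 0" "\<And>s. poly R s \<noteq> 0 \<Longrightarrow> \<phi> s * poly R s = poly Q s"
    "F * fps_of_poly R = fps_of_poly Q" using assms(1) unfolding has_expansion_def by blast
  obtain Q' R' where 2: "poly R' 0 \<noteq> 0" "\<And>s. poly R' s \<noteq> 0 \<Longrightarrow> \<psi> s * poly R' s = poly Q' s"
    "G * fps_of_poly R' = fps_of_poly Q'" using assms(2) unfolding has_expansion_def by blast
  show ?thesis
  proof (rule has_expansionI[of "R * R'" _ "Q * R' + Q' * R"])
    fix s assume "poly (R * R') s \<noteq> 0"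
    then have "poly Q s = \<phi> s * poly R s" "poly Q' s = \<psi> s * poly R' s" using 1(2) 2(2) by auto
    then show "(\<phi> s + \<psi> s) * poly (R * R') s = poly (Q * R' + Q' * R) s" by (simp add: algebra_simps)
  qed (use 1(1) 2(1) in \<open>simp_all add: fps_of_poly_mult fps_of_poly_add algebra_simps flip: 1(3) 2(3)\<close>)
qed

lemma has_expansion_mult:
  assumes "has_expansion \<phi> F" and "has_expansion \<psi> G"
  shows "has_expansion (\<lambda>s. \<phi> s * \<psi> s) (F * G)"
proof -
  obtain Q R where 1: "poly R 0 \<noteq> 0" "\<And>s. poly R s \<noteq> 0 \<Longrightarrow> \<phi> s * poly R s = poly Q s"
    "F * fps_of_poly R = fps_of_poly Q" using assms(1) unfolding has_expansion_def by blast
  obtain Q' R' where 2: "poly R' 0 \<noteq> 0" "\<And>s. poly R' s \<noteq> 0 \<Longrightarrow> \<psi> s * poly R' s = poly Q' s"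
    "G * fps_of_poly R' = fps_of_poly Q'" using assms(2) unfolding has_expansion_def by blast
  show ?thesis
  proof (rule has_expansionI[of "R * R'" _ "Q * Q'"])
    fix s assume "poly (R * R') s \<noteq> 0"
    then have "poly Q s = \<phi> s * poly R s" "poly Q' s = \<psi> s * poly R' s" using 1(2) 2(2) by auto
    then show "\<phi> s * \<psi> s * poly (R * R') s = poly (Q * Q') s" by (simp add: algebra_simps)
  qed (use 1(1) 2(1) in \<open>simp_all add: fps_of_poly_mult algebra_simps flip: 1(3) 2(3)\<close>)
qed

lemma has_expansion_inverse:
  assumes "has_expansion \<phi> F" and "fps_nth F 0 \<noteq> 0"
  shows "has_expansion (\<lambda>s. inverse (\<phi> s)) (inverse F)"
proof -
  obtain Q R where 1: "poly R 0 \<noteq> 0" "\<And>s. poly R s \<noteq> 0 \<Longrightarrow> \<phi> s * poly R s = poly Q s"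
    "F * fps_of_poly R = fps_of_poly Q" using assms(1) unfolding has_expansion_def by blast
  have Q: "poly Q 0 \<noteq> 0" using has_expansion_nth_0[OF assms(1)] assms(2) 1(1) 1(2)[of 0] by (metis mult_eq_0_iff)
  have "inverse F * F = 1" using assms(2) by (rule inverse_mult_eq_1)
  then have i: "inverse F * (F * G) = G" for G by (simp flip: mult.assoc)
  show ?thesis
  proof (rule has_expansionI[of "Q * R" _ "R * R"])
    fix s assume "poly (Q * R) s \<noteq> 0"
    then have "poly Q s = \<phi> s * poly R s" "poly Q s \<noteq> 0" using 1(2) by auto
    then show "inverse (\<phi> s) * poly (Q * R) s = poly (R * R) s" by simp
  qed (use 1(1) Q in \<open>simp_all add: fps_of_poly_mult i mult.assoc flip: 1(3)\<close>)
qed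

lemma has_expansion_power:
  "has_expansion \<phi> F \<Longrightarrow> has_expansion (\<lambda>s. \<phi> s ^ k) (F ^ k)"
  by (induction k) (use has_expansion_const[of 1] in \<open>auto intro: has_expansion_mult\<close>)

text \<open>Only the first two coefficients are recorded: they determine how a root vector acts.\<close>

lemma has_expansion_powi:
  assumes "has_expansion \<phi> F" and "fps_nth F 0 = 1"
  shows "\<exists>G. has_expansion (\<lambda>s. \<phi> s powi m) G \<and> fps_nth G 0 = 1 \<and> fps_nth G 1 = of_int m * fps_nth F 1"
proof -
  have pow: "fps_nth (F ^ k) 0 = 1 \<and> fps_nth (F ^ k) 1 = of_nat k * fps_nth F 1" for k
    by (induction k) (auto simp: fps_mult_nth_1 assms(2) algebra_simps)
  show ?thesis
  proof (cases "m \<ge> 0")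
    case True
    then show ?thesis using has_expansion_power[OF assms(1), of "nat m"] pow[of "nat m"]
      by (intro exI[of _ "F ^ nat m"]) (auto simp: power_int_def)
  next
    case False
    let ?G = "inverse (F ^ nat (- m))"
    have p: "fps_nth (F ^ nat (- m)) 0 = 1" "fps_nth (F ^ nat (- m)) 1 = of_nat (nat (-m)) * fps_nth F 1"
      using pow by blast+
    have "inverse (F ^ nat (- m)) * (F ^ nat (- m)) = 1" by (rule inverse_mult_eq_1) (simp add: p)
    from arg_cong[OF this, of "\<lambda>f. fps_nth f 1"]
    have "fps_nth ?G 1 = of_int m * fps_nth F 1"
      using False unfolding fps_mult_nth_1 p by (simp add: p assms algebra_simps of_nat_nat eq_neg_iff_add_eq_0)
    moreover have "has_expansion (\<lambda>s. \<phi> s powi m) ?G"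
      using has_expansion_inverse[OF has_expansion_power[OF assms(1), of "nat (-m)"]] p False
      by (simp add: power_int_def power_inverse)
    moreover have "fps_nth ?G 0 = 1" using p by simp
    ultimately show ?thesis by blast
  qed
qed

text \<open>The chain rule at \<open>0\<close>, for reparametrisations of a one-parameter subgroup.\<close>

lemma has_expansion_poly_compose:
  assumes "has_expansion \<sigma> S" and "fps_nth S 0 = 0"
  shows "\<exists>G. has_expansion (\<lambda>s. poly P (\<sigma> s)) G \<and> fps_nth G 0 = poly.coeff P 0 \<and> fps_nth G 1 = poly.coeff P 1 * fps_nth S 1"
proof (induction P)
  case 0
  then show ?case using has_expansion_const[of 0] by (intro exI[of _ 0]) auto
next
  case (pCons a P)
  then obtain G where G: "has_expansion (\<lambda>s. poly P (\<sigma> s)) G" "fps_nth G 0 = poly.coeff P 0" by blast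
  show ?case
    by (rule exI[of _ "fps_const a + S * G"])
       (use has_expansion_add[OF has_expansion_const[of a] has_expansion_mult[OF assms(1) G(1)]] G assms
        in \<open>auto simp: fps_mult_nth_1\<close>)
qed

text \<open>The functions to which \<open>expansion_coeff\<close> applies: the expansion it takes is that of \<open>Q / (1 + X)\<^sup>k\<close>.\<close>

definition regular_off_minus_1 :: "('k::field \<Rightarrow> 'k) \<Rightarrow> bool" where
  "regular_off_minus_1 \<phi> \<longleftrightarrow> (\<exists>Q k. \<forall>t. t \<noteq> - 1 \<longrightarrow> \<phi> t * (1 + t) ^ k = poly Q t)"

lemma has_expansion_quotient:
  fixes \<phi> :: "'k::field \<Rightarrow> 'k"
  assumes "\<And>t. t \<noteq> - 1 \<Longrightarrow> \<phi> t * (1 + t) ^ k = poly Q t"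
  shows "has_expansion \<phi> (fps_of_poly Q / (1 + fps_X) ^ k)"
\<comment> \<open>The exponent \<open>Suc k\<close> makes the denominator vanish at \<open>-1\<close> even for \<open>k = 0\<close>.\<close>
proof (rule has_expansionI[of "[:1, 1:] ^ Suc k" _ "Q * [:1, 1:]"])
  have e: "fps_of_poly [:1, 1:] = (1 + fps_X :: 'k fps)"
    by (simp add: fps_of_poly_pCons)
  have "inverse ((1 + fps_X :: 'k fps) ^ k) * (1 + fps_X) ^ k = 1"
    by (rule inverse_mult_eq_1) simp
  then have "fps_of_poly Q / (1 + fps_X) ^ k * (1 + fps_X) ^ k = fps_of_poly Q"
    by (simp add: fps_divide_unit mult.assoc)
  then show "fps_of_poly Q / (1 + fps_X) ^ k * fps_of_poly ([:1, 1:] ^ Suc k) = fps_of_poly (Q * [:1, 1:])"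
    unfolding fps_of_poly_mult fps_of_poly_power e by (metis mult.assoc mult.commute power_Suc)
  show "\<phi> s * poly ([:1, 1:] ^ Suc k) s = poly (Q * [:1, 1:]) s" if "poly ([:1, 1:] ^ Suc k) s \<noteq> 0" for s
  proof -
    have "s \<noteq> - 1" using that by auto
    from assms[OF this] have "\<phi> s * (1 + s) ^ k * (1 + s) = poly Q s * (1 + s)" by simp
    moreover have "poly [:1, 1:] s = 1 + s" by simp
    ultimately show ?thesis by (simp only: poly_mult poly_power power_Suc2 mult.assoc)
  qed
qed simp

lemma expansion_coeff_eq_nth:
  fixes \<phi> :: "'k::alg_closed_field \<Rightarrow> 'k"
  assumes "regular_off_minus_1 \<phi>" and "has_expansion \<phi> F"
  shows "expansion_coeff \<phi> r = fps_nth F r"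
  unfolding expansion_coeff_def
proof (rule the_equality)
  obtain Q k where Q: "\<And>t. t \<noteq> - 1 \<Longrightarrow> \<phi> t * (1 + t) ^ k = poly Q t"
    using assms(1) unfolding regular_off_minus_1_def by blast
  then have "F = fps_of_poly Q / (1 + fps_X) ^ k"
    using has_expansion_unique[OF assms(2) has_expansion_quotient] by blast
  with Q show "\<exists>Q k. (\<forall>t. t \<noteq> - 1 \<longrightarrow> \<phi> t * (1 + t) ^ k = poly Q t) \<and>
      fps_nth F r = fps_nth (fps_of_poly Q / (1 + fps_X) ^ k) r" by blast
next
  fix c assume "\<exists>Q k. (\<forall>t. t \<noteq> - 1 \<longrightarrow> \<phi> t * (1 + t) ^ k = poly Q t) \<and>
      c = fps_nth (fps_of_poly Q / (1 + fps_X) ^ k) r"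
  then obtain Q k where Q: "\<And>t. t \<noteq> - 1 \<Longrightarrow> \<phi> t * (1 + t) ^ k = poly Q t"
    "c = fps_nth (fps_of_poly Q / (1 + fps_X) ^ k) r" by blast
  then show "c = fps_nth F r" using has_expansion_unique[OF assms(2) has_expansion_quotient] by metis
qed

lemma expansion_coeff_poly:
  fixes P :: "'k::alg_closed_field poly"
  assumes "\<And>t. \<phi> t = poly P t"
  shows "expansion_coeff \<phi> r = poly.coeff P r"
proof -
  have "\<phi> = poly P" using assms by auto
  moreover have "regular_off_minus_1 (poly P)"
    unfolding regular_off_minus_1_def by (rule exI[of _ P], rule exI[of _ 0]) simp
  ultimately show ?thesis using expansion_coeff_eq_nth[OF _ has_expansion_poly] by simp
qed

lemma has_expansion_exists:
  assumes "regular_off_minus_1 \<phi>" shows "\<exists>F. has_expansion \<phi> F"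
  using assms has_expansion_quotient unfolding regular_off_minus_1_def by blast

lemma regular_off_minus_1_eqI:
  fixes \<phi> \<psi> :: "'k::alg_closed_field \<Rightarrow> 'k"
  assumes "regular_off_minus_1 \<phi>" and "regular_off_minus_1 \<psi>"
    and "has_expansion \<phi> F" and "has_expansion \<psi> F" and "t \<noteq> - 1"
  shows "\<phi> t = \<psi> t"
proof -
  obtain Q k where Q: "\<And>t. t \<noteq> - 1 \<Longrightarrow> \<phi> t * (1 + t) ^ k = poly Q t"
    using assms(1) unfolding regular_off_minus_1_def by blast
  obtain Q' k' where Q': "\<And>t. t \<noteq> - 1 \<Longrightarrow> \<psi> t * (1 + t) ^ k' = poly Q' t"
    using assms(2) unfolding regular_off_minus_1_def by blast
  have e: "fps_of_poly [:1, 1:] = (1 + fps_X :: 'k fps)" by (simp add: fps_of_poly_pCons)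
  have cancel: "fps_of_poly Q / (1 + fps_X) ^ k * (1 + fps_X) ^ k = fps_of_poly Q" for Q :: "'k poly" and k
  proof -
    have "inverse ((1 + fps_X :: 'k fps) ^ k) * (1 + fps_X) ^ k = 1"
      by (rule inverse_mult_eq_1) simp
    then show ?thesis by (simp add: fps_divide_unit mult.assoc)
  qed
  have "fps_of_poly Q / (1 + fps_X) ^ k = F" "fps_of_poly Q' / (1 + fps_X) ^ k' = F"
    using has_expansion_unique[OF assms(3) has_expansion_quotient[OF Q]]
      has_expansion_unique[OF assms(4) has_expansion_quotient[OF Q']] by auto
  then have "fps_of_poly Q = F * (1 + fps_X) ^ k" "fps_of_poly Q' = F * (1 + fps_X) ^ k'"
    using cancel by metis+
  then have "fps_of_poly (Q * [:1, 1:] ^ k') = fps_of_poly (Q' * [:1, 1:] ^ k)"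
    by (simp add: fps_of_poly_mult fps_of_poly_power e mult_ac)
  then have "poly Q t * (1 + t) ^ k' = poly Q' t * (1 + t) ^ k"
    unfolding fps_of_poly_eq_iff by (drule_tac arg_cong[of _ _ "\<lambda>p. poly p t"]) (simp add: poly_power)
  then have "\<phi> t * (1 + t) ^ k * (1 + t) ^ k' = \<psi> t * (1 + t) ^ k' * (1 + t) ^ k"
    by (simp only: Q[OF assms(5)] Q'[OF assms(5)])
  then have "\<phi> t * ((1 + t) ^ k * (1 + t) ^ k') = \<psi> t * ((1 + t) ^ k * (1 + t) ^ k')"
    by (simp only: mult_ac)
  moreover have "(1 + t) ^ k * (1 + t) ^ k' \<noteq> 0"
    using assms(5) by (auto simp: eq_neg_iff_add_eq_0 add.commute)
  ultimately show ?thesis by (metis mult_right_cancel)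
qed

section \<open>Binomial series with integral exponent\<close>

lemma int_binom_Suc_Suc: "int_binom (a + 1) (Suc r) = int_binom a r + int_binom a (Suc r)"
  by (rule gbinomial_int_Suc_Suc[unfolded gbinomial_prod_rev, folded int_binom_def])

lemma int_binom_0_Suc: "int_binom 0 (Suc r) = 0"
proof -
  have "(\<Prod>k = 0..<Suc r. 0 - int k) = 0" by (rule prod_zero) auto
  then show ?thesis by (simp only: int_binom_def) simp
qed

definition binomial_fps :: "int \<Rightarrow> 'k::field fps" where
  "binomial_fps a = (if a \<ge> 0 then (1 + fps_X) ^ nat a else inverse ((1 + fps_X) ^ nat (- a)))"

lemma binomial_fps_0: "fps_nth (binomial_fps a :: 'k::field fps) 0 = 1"
  by (simp add: binomial_fps_def fps_power_zeroth)

lemma binomial_fps_add_1: "(binomial_fps (a + 1) :: 'k::field fps) = binomial_fps a * (1 + fps_X)"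
proof (cases "a \<ge> 0")
  case True
  then show ?thesis by (simp add: binomial_fps_def nat_add_distrib)
next
  case False
  define b where "b = nat (- a - 1)"
  have b: "a = - int b - 1" using False by (simp add: b_def)
  have i: "inverse (1 + fps_X :: 'k fps) * (1 + fps_X) = 1" by (rule inverse_mult_eq_1) simp
  have "binomial_fps (a + 1) = inverse ((1 + fps_X :: 'k fps) ^ b)"
    by (cases "b = 0") (simp_all add: binomial_fps_def b)
  moreover have "binomial_fps a = inverse ((1 + fps_X :: 'k fps) ^ b) * inverse (1 + fps_X)"
    by (simp add: binomial_fps_def b nat_add_distrib fps_inverse_mult mult.commute)
  ultimately show ?thesis by (simp add: mult.assoc i)
qed

lemma binomial_fps_Suc:
  "fps_nth (binomial_fps (a + 1) :: 'k::field fps) (Suc r) = fps_nth (binomial_fps a) (Suc r) + fps_nth (binomial_fps a) r"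
  unfolding binomial_fps_add_1 by (simp add: distrib_left)

text \<open>Both sides obey Pascal's rule and agree for \<open>a = 0\<close>; by induction on \<open>a\<close> in both directions the
  binomial series with integral exponent therefore has integral binomial coefficients, in any
  characteristic.\<close>

lemma binomial_fps_nth: "fps_nth (binomial_fps a :: 'k::field fps) r = of_int (int_binom a r)"
proof (induction r arbitrary: a)
  case 0
  then show ?case by (simp add: binomial_fps_0 int_binom_def)
next
  case (Suc r)
  \<comment> \<open>For fixed \<open>r\<close> the defect does not depend on \<open>a\<close>.\<close>
  have step: "fps_nth (binomial_fps (a + 1) :: 'k fps) (Suc r) - of_int (int_binom (a + 1) (Suc r)) =
      fps_nth (binomial_fps a) (Suc r) - of_int (int_binom a (Suc r))" for a
    using Suc[of a] by (simp add: binomial_fps_Suc int_binom_Suc_Suc)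
  have "fps_nth (binomial_fps a :: 'k fps) (Suc r) - of_int (int_binom a (Suc r)) = 0"
  proof (induction a rule: int_induct[of _ 0])
    case base
    show ?case by (simp add: binomial_fps_def int_binom_0_Suc)
  next
    case (step1 i)
    then show ?case using step[of i] by simp
  next
    case (step2 i)
    then show ?case using step[of "i - 1"] by simp
  qed
  then show ?case by simp
qed

lemma powi_has_expansion: "has_expansion (\<lambda>t :: 'k::field. (1 + t) powi a) (binomial_fps a)"
proof -
  have e: "fps_of_poly [:1, 1:] = (1 + fps_X :: 'k fps)" "poly [:1, 1:] = (\<lambda>t :: 'k. 1 + t)"
    by (auto simp: fps_of_poly_pCons)
  have p: "has_expansion (\<lambda>t :: 'k. (1 + t) ^ k) ((1 + fps_X) ^ k)" for k
    using has_expansion_power[OF has_expansion_poly[of "[:1, 1 :: 'k:]"], of k] by (simp only: e)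
  show ?thesis
    using p[of "nat a"] has_expansion_inverse[OF p[of "nat (- a)"]]
    by (auto simp: binomial_fps_def power_int_def power_inverse)
qed

lemma powi_regular: "regular_off_minus_1 (\<lambda>t :: 'k::field. (1 + t) powi a * c)"
proof (cases "a \<ge> 0")
  case True
  then show ?thesis unfolding regular_off_minus_1_def
    by (intro exI[of _ "[:c:] * [:1, 1:] ^ nat a"] exI[of _ 0]) (auto simp: power_int_def poly_power)
next
  case False
  have "(1 + t) powi a * c * (1 + t) ^ nat (- a) = c" if "t \<noteq> - 1" for t :: 'k
  proof -
    have "1 + t \<noteq> 0" using that by (auto simp: eq_neg_iff_add_eq_0 add.commute)
    then show ?thesis using False by (simp add: power_int_def power_inverse)
  qed
  then show ?thesis unfolding regular_off_minus_1_def
    by (intro exI[of _ "[:c:]"] exI[of _ "nat (- a)"]) auto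
qed

section \<open>Regular functions along curves of matrices\<close>

definition polynomial_fun :: "('k::field \<Rightarrow> 'k) \<Rightarrow> bool" where
  "polynomial_fun \<phi> \<longleftrightarrow> (\<exists>P. \<forall>t. \<phi> t = poly P t)"

lemma polynomial_fun_const: "polynomial_fun (\<lambda>_. c)"
  unfolding polynomial_fun_def by (rule exI[of _ "[:c:]"]) simp

lemma polynomial_fun_id: "polynomial_fun (\<lambda>t. t)"
  unfolding polynomial_fun_def by (rule exI[of _ "[:0, 1:]"]) simp

lemma polynomial_fun_add: "polynomial_fun \<phi> \<Longrightarrow> polynomial_fun \<psi> \<Longrightarrow> polynomial_fun (\<lambda>t. \<phi> t + \<psi> t)"
  unfolding polynomial_fun_def by (metis poly_add)

lemma polynomial_fun_mult: "polynomial_fun \<phi> \<Longrightarrow> polynomial_fun \<psi> \<Longrightarrow> polynomial_fun (\<lambda>t. \<phi> t * \<psi> t)"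
  unfolding polynomial_fun_def by (metis poly_mult)

lemma polynomial_fun_sum:
  "(\<And>x. x \<in> A \<Longrightarrow> polynomial_fun (\<phi> x)) \<Longrightarrow> polynomial_fun (\<lambda>t. \<Sum>x\<in>A. \<phi> x t)"
  by (induction A rule: infinite_finite_induct) (auto intro: polynomial_fun_const polynomial_fun_add)

lemma polynomial_fun_prod:
  "(\<And>x. x \<in> A \<Longrightarrow> polynomial_fun (\<phi> x)) \<Longrightarrow> polynomial_fun (\<lambda>t. \<Prod>x\<in>A. \<phi> x t)"
  by (induction A rule: infinite_finite_induct) (auto intro: polynomial_fun_const polynomial_fun_mult)

lemmas polynomial_fun_intros =
  polynomial_fun_const polynomial_fun_id polynomial_fun_add polynomial_fun_mult

definition polynomial_curve :: "nat \<Rightarrow> ('k::field \<Rightarrow> 'k mat) \<Rightarrow> bool" where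
  "polynomial_curve n M \<longleftrightarrow>
     (\<forall>t. M t \<in> carrier_mat n n) \<and> (\<forall>a<n. \<forall>b<n. polynomial_fun (\<lambda>t. M t $$ (a, b)))"

lemma polynomial_fun_det:
  assumes "polynomial_curve n M"
  shows "polynomial_fun (\<lambda>t. det (M t))"
proof -
  have "det (M t) = (\<Sum>p\<in>{p. p permutes {0..<n}}. signof p * (\<Prod>i = 0..<n. M t $$ (i, p i)))" for t
    using assms det_def'[of "M t" n] unfolding polynomial_curve_def by auto
  moreover have "polynomial_fun (\<lambda>t. \<Sum>p\<in>{p. p permutes {0..<n}}. signof p * (\<Prod>i = 0..<n. M t $$ (i, p i)))"
  proof (intro polynomial_fun_sum polynomial_fun_mult polynomial_fun_const polynomial_fun_prod)
    fix p i assume "p \<in> {p. p permutes {0..<n}}" "i \<in> {0..<n}"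
    then have "i < n" "p i < n" using permutes_in_image[of p "{0..<n}" i] by auto
    then show "polynomial_fun (\<lambda>t. M t $$ (i, p i))" using assms unfolding polynomial_curve_def by auto
  qed
  ultimately show ?thesis by simp
qed

text \<open>The only denominators of regular functions are powers of the determinant.\<close>

lemma regular_along_curve:
  assumes "f \<in> coordinate_ring n" and M: "polynomial_curve n M"
  shows "\<exists>k Q. \<forall>t. M t \<in> GL n \<longrightarrow> f (M t) * det (M t) ^ k = poly Q t"
proof -
  obtain D where D: "\<And>t. det (M t) = poly D t"
    using polynomial_fun_det[OF M] unfolding polynomial_fun_def by blast
  have "\<exists>k Q. \<forall>t. poly D t \<noteq> 0 \<longrightarrow> h (M t) * poly D t ^ k = poly Q t" if "h \<in> regular_expr n" for h
    using that
  proof (induction h rule: regular_expr.induct)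
    case (const c)
    then show ?case by (intro exI[of _ 0] exI[of _ "[:c:]"]) simp
  next
    case (entry i j)
    then obtain P where "\<And>t. M t $$ (i, j) = poly P t"
      using M unfolding polynomial_curve_def polynomial_fun_def by blast
    then show ?case by (intro exI[of _ 0] exI[of _ P]) simp
  next
    case inv_det
    then show ?case by (intro exI[of _ 1] exI[of _ 1]) (simp add: D)
  next
    case (add f1 f2)
    then obtain k1 Q1 k2 Q2 where
      "\<And>t. poly D t \<noteq> 0 \<Longrightarrow> f1 (M t) * poly D t ^ k1 = poly Q1 t"
      "\<And>t. poly D t \<noteq> 0 \<Longrightarrow> f2 (M t) * poly D t ^ k2 = poly Q2 t" by blast
    note 1 = this
    show ?case
    proof (intro exI[of _ "k1 + k2"] exI[of _ "Q1 * D ^ k2 + Q2 * D ^ k1"] allI impI)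
      fix t assume "poly D t \<noteq> 0"
      from 1[OF this, symmetric]
      show "(f1 (M t) + f2 (M t)) * poly D t ^ (k1 + k2) = poly (Q1 * D ^ k2 + Q2 * D ^ k1) t"
        by (simp add: poly_power power_add algebra_simps)
    qed
  next
    case (mult f1 f2)
    then obtain k1 Q1 k2 Q2 where
      "\<And>t. poly D t \<noteq> 0 \<Longrightarrow> f1 (M t) * poly D t ^ k1 = poly Q1 t"
      "\<And>t. poly D t \<noteq> 0 \<Longrightarrow> f2 (M t) * poly D t ^ k2 = poly Q2 t" by blast
    note 1 = this
    show ?case
    proof (intro exI[of _ "k1 + k2"] exI[of _ "Q1 * Q2"] allI impI)
      fix t assume "poly D t \<noteq> 0"
      from 1[OF this, symmetric]
      show "f1 (M t) * f2 (M t) * poly D t ^ (k1 + k2) = poly (Q1 * Q2) t"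
        by (simp add: power_add algebra_simps)
    qed
  qed
  moreover obtain h where "h \<in> regular_expr n" and h: "\<And>g. g \<in> GL n \<Longrightarrow> f g = h g"
    using assms(1) unfolding coordinate_ring_def by blast
  ultimately obtain k Q where "\<And>t. poly D t \<noteq> 0 \<Longrightarrow> h (M t) * poly D t ^ k = poly Q t" by blast
  then show ?thesis
    using h D by (intro exI[of _ k] exI[of _ Q]) (auto simp: GL_def)
qed

text \<open>The density argument: a rational function of one variable that vanishes at all but finitely many
  points of an infinite field vanishes.\<close>

lemma vanishes_along_curve:
  fixes f :: "'k::alg_closed_field mat \<Rightarrow> 'k"
  assumes "f \<in> coordinate_ring n" and M: "polynomial_curve n M" and "finite S"
    and van: "\<And>t. t \<notin> S \<Longrightarrow> M t \<in> GL n \<Longrightarrow> f (M t) = 0" and g: "M t\<^sub>0 \<in> GL n"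
  shows "f (M t\<^sub>0) = 0"
proof -
  obtain D where D: "\<And>t. det (M t) = poly D t"
    using polynomial_fun_det[OF M] unfolding polynomial_fun_def by blast
  obtain k Q where Q: "\<And>t. M t \<in> GL n \<Longrightarrow> f (M t) * det (M t) ^ k = poly Q t"
    using regular_along_curve[OF assms(1) M] by blast
  have "Q = 0"
  proof (rule poly_eq_0_cofinite[OF _ assms(3)])
    show "D \<noteq> 0" using g D[of t\<^sub>0] by (auto simp: GL_def)
    fix t assume t: "t \<notin> S" "poly D t \<noteq> 0"
    then have "M t \<in> GL n" using M by (auto simp: GL_def polynomial_curve_def D)
    then show "poly Q t = 0" using Q[of t] van[OF t(1)] by simp
  qed
  then show ?thesis using Q[OF g] g by (simp add: GL_def)
qed

section \<open>Elementary matrices\<close>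

lemma mult_elem_mat:
  assumes "g \<in> carrier_mat n n" "i < n" "j < n" "a < n" "b < n"
  shows "(g * elem_mat n (Suc i) (Suc j) t) $$ (a, b) = g $$ (a, b) + (if b = j then t * g $$ (a, i) else 0)"
proof -
  have "(g * elem_mat n (Suc i) (Suc j) t) $$ (a, b) =
      (\<Sum>k = 0..<n. g $$ (a, k) * ((if k = b then 1 else 0) + (if k = i \<and> b = j then t else 0)))"
    using assms by (auto simp: elem_mat_def scalar_prod_def intro!: sum.cong)
  also have "\<dots> = (\<Sum>k = 0..<n. (if k = b then g $$ (a, k) else 0) + (if k = i then (if b = j then t * g $$ (a, k) else 0) else 0))"
    by (rule sum.cong) (auto simp: distrib_left)
  also have "\<dots> = g $$ (a, b) + (if b = j then t * g $$ (a, i) else 0)"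
    using assms by (subst sum.distrib, subst (1 2) sum.delta) auto
  finally show ?thesis .
qed

lemma elem_mat_mult:
  assumes "g \<in> carrier_mat n n" "i < n" "j < n" "a < n" "b < n"
  shows "(elem_mat n (Suc i) (Suc j) t * g) $$ (a, b) = g $$ (a, b) + (if a = i then t * g $$ (j, b) else 0)"
proof -
  have "(elem_mat n (Suc i) (Suc j) t * g) $$ (a, b) =
      (\<Sum>k = 0..<n. ((if k = a then 1 else 0) + (if a = i \<and> k = j then t else 0)) * g $$ (k, b))"
    using assms by (auto simp: elem_mat_def scalar_prod_def intro!: sum.cong)
  also have "\<dots> = (\<Sum>k = 0..<n. (if k = a then g $$ (k, b) else 0) + (if k = j then (if a = i then t * g $$ (k, b) else 0) else 0))"
    by (rule sum.cong) (auto simp: distrib_right)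
  also have "\<dots> = g $$ (a, b) + (if a = i then t * g $$ (j, b) else 0)"
    using assms by (subst sum.distrib, subst (1 2) sum.delta) auto
  finally show ?thesis .
qed

lemma elem_mat_carrier [simp]: "elem_mat n i j t \<in> carrier_mat n n"
  by (simp add: elem_mat_def)

lemma elem_mat_dim [simp]: "dim_row (elem_mat n i j t) = n" "dim_col (elem_mat n i j t) = n"
  by (simp_all add: elem_mat_def)

lemma mult_elem_mat_carrier: "h \<in> carrier_mat n n \<Longrightarrow> h * elem_mat n i j s \<in> carrier_mat n n"
  by simp

lemma det_elem_mat:
  assumes "i < n" "j < n"
  shows "det (elem_mat n (Suc i) (Suc j) t :: 'k::field mat) = (if i = j then 1 + t else 1)"
proof (cases "i = j")
  case True
  have "elem_mat n (Suc i) (Suc i) t = multrow_mat n i (1 + t)"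
    by (rule eq_matI) (auto simp: elem_mat_def multrow_mat_def)
  then show ?thesis using True assms det_multrow_mat by auto
next
  case False
  have "elem_mat n (Suc i) (Suc j) t = addrow_mat n t i j"
    by (rule eq_matI) (use False in \<open>auto simp: elem_mat_def addrow_mat_def\<close>)
  then show ?thesis using False det_addrow_mat by auto
qed

lemma GL_carrier: "g \<in> GL n \<Longrightarrow> g \<in> carrier_mat n n" by (simp add: GL_def)

lemma GL_mult: "g \<in> GL n \<Longrightarrow> h \<in> GL n \<Longrightarrow> g * h \<in> GL n"
  by (auto simp: GL_def det_mult)

lemma elem_mat_GL:
  assumes "i < n" "j < n" "i = j \<longrightarrow> t \<noteq> - 1"
  shows "elem_mat n (Suc i) (Suc j) t \<in> GL n"
  using assms by (auto simp: GL_def det_elem_mat eq_neg_iff_add_eq_0 add.commute)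

lemma polynomial_curve_elem_mat:
  assumes "g \<in> carrier_mat n n" "i < n" "j < n"
  shows "polynomial_curve n (\<lambda>t. g * elem_mat n (Suc i) (Suc j) t)"
  unfolding polynomial_curve_def
proof (intro conjI allI impI)
  fix a b assume "a < n" "b < n"
  then show "polynomial_fun (\<lambda>t. (g * elem_mat n (Suc i) (Suc j) t) $$ (a, b))"
    by (cases "b = j") (auto simp: mult_elem_mat assms intro!: polynomial_fun_intros)
qed (use assms in auto)

lemma elem_mat_off_diagonal_polynomial:
  fixes f :: "'k::alg_closed_field mat \<Rightarrow> 'k"
  assumes "f \<in> coordinate_ring n" and g: "g \<in> GL n" and ij: "i < n" "j < n" "i \<noteq> j"
  shows "\<exists>P. \<forall>t. f (g * elem_mat n (Suc i) (Suc j) t) = poly P t"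
proof -
  have d: "det (g * elem_mat n (Suc i) (Suc j) t) = det g" for t
    using g ij by (simp add: GL_def det_mult[of _ n] det_elem_mat)
  obtain k Q where Q: "\<And>t. g * elem_mat n (Suc i) (Suc j) t \<in> GL n \<Longrightarrow>
      f (g * elem_mat n (Suc i) (Suc j) t) * det (g * elem_mat n (Suc i) (Suc j) t) ^ k = poly Q t"
    using regular_along_curve[OF assms(1) polynomial_curve_elem_mat[OF GL_carrier[OF g] ij(1,2)]] by blast
  have "f (g * elem_mat n (Suc i) (Suc j) t) = poly (Polynomial.smult (inverse (det g ^ k)) Q) t" for t
    using Q[OF GL_mult[OF g elem_mat_GL], of t] ij g by (simp add: d GL_def field_simps)
  then show ?thesis by blast
qed

lemma elem_mat_diagonal_regular:
  fixes f :: "'k::alg_closed_field mat \<Rightarrow> 'k"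
  assumes "f \<in> coordinate_ring n" and g: "g \<in> GL n" and i: "i < n"
  shows "regular_off_minus_1 (\<lambda>t. f (g * elem_mat n (Suc i) (Suc i) t))"
proof -
  have d: "det (g * elem_mat n (Suc i) (Suc i) t) = det g * (1 + t)" for t
    using g i by (simp add: GL_def det_mult[of _ n] det_elem_mat)
  obtain k Q where Q: "\<And>t. g * elem_mat n (Suc i) (Suc i) t \<in> GL n \<Longrightarrow>
      f (g * elem_mat n (Suc i) (Suc i) t) * det (g * elem_mat n (Suc i) (Suc i) t) ^ k = poly Q t"
    using regular_along_curve[OF assms(1) polynomial_curve_elem_mat[OF GL_carrier[OF g] i i]] by blast
  have "f (g * elem_mat n (Suc i) (Suc i) t) * (1 + t) ^ k = poly (Polynomial.smult (inverse (det g ^ k)) Q) t"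
    if "t \<noteq> - 1" for t
  proof -
    have "f (g * elem_mat n (Suc i) (Suc i) t) * (det g * (1 + t)) ^ k = poly Q t"
      using Q[OF GL_mult[OF g elem_mat_GL], of t] i that unfolding d by blast
    then have e: "f (g * elem_mat n (Suc i) (Suc i) t) * (1 + t) ^ k * det g ^ k = poly Q t"
      by (simp only: power_mult_distrib mult_ac)
    then show ?thesis using g by (simp add: GL_def flip: e)
  qed
  then show ?thesis unfolding regular_off_minus_1_def by blast
qed

section \<open>Functions on the group with an equivariance on each side\<close>

lemma costandardD:
  assumes "f \<in> costandard n lam"
  shows "f \<in> coordinate_ring n"
    and "b \<in> lower_borel n \<Longrightarrow> g \<in> GL n \<Longrightarrow> f (b * g) = borel_char n lam b * f g"
  using assms unfolding costandard_def by auto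

lemma costandard_eqI:
  assumes "f \<in> costandard n lam" and "\<And>g. g \<in> GL n \<Longrightarrow> f g = 0"
  shows "f = (\<lambda>_. 0)"
  using assms unfolding costandard_def coordinate_ring_def by auto

lemma lower_borel_GL: "b \<in> lower_borel n \<Longrightarrow> b \<in> GL n"
  by (simp add: lower_borel_def)

lemma lower_borelI:
  assumes "b \<in> carrier_mat n n" and "\<And>a c. a < c \<Longrightarrow> c < n \<Longrightarrow> b $$ (a, c) = 0"
    and "\<And>a. a < n \<Longrightarrow> b $$ (a, a) \<noteq> 0"
  shows "b \<in> lower_borel n"
proof -
  have "det b = (\<Prod>a = 0..<n. b $$ (a, a))"
    using det_lower_triangular[OF assms(2) assms(1)] assms(1) by (simp add: prod_list_diag_prod)
  then have "det b \<noteq> 0" using assms(3) by simp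
  then show ?thesis using assms unfolding lower_borel_def GL_def by auto
qed

lemma elem_mat_lower_borel:
  assumes "j < i" "i < n"
  shows "elem_mat n (Suc i) (Suc j) t \<in> lower_borel n"
    and "borel_char n lam (elem_mat n (Suc i) (Suc j) t :: 'k::field mat) = 1"
  using assms by (auto intro!: lower_borelI prod.neutral simp: elem_mat_def borel_char_def split: if_splits)

lemma elem_mat_diagonal_borel:
  assumes "i < n" "t \<noteq> - 1"
  shows "elem_mat n (Suc i) (Suc i) t \<in> lower_borel n"
    and "borel_char n lam (elem_mat n (Suc i) (Suc i) t :: 'k::field mat) = (1 + t) powi lam (Suc i)"
proof -
  have "1 + t \<noteq> 0" using assms(2) by (auto simp: eq_neg_iff_add_eq_0 add.commute)
  then show "elem_mat n (Suc i) (Suc i) t \<in> lower_borel n"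
    using assms by (auto intro!: lower_borelI simp: elem_mat_def split: if_splits)
  have "borel_char n lam (elem_mat n (Suc i) (Suc i) t :: 'k mat) =
      (\<Prod>a<n. if a = i then (1 + t) powi lam (Suc i) else 1)"
    unfolding borel_char_def by (rule prod.cong) (auto simp: elem_mat_def)
  then show "borel_char n lam (elem_mat n (Suc i) (Suc i) t :: 'k mat) = (1 + t) powi lam (Suc i)"
    using assms(1) by simp
qed

text \<open>Gaussian elimination. Left multiplication by a lower triangular matrix changes \<open>f\<close> by a non-zero
  factor, so a column can be cleared below a non-zero pivot. Along the line
  \<open>g + t\<close> the pivot is non-zero for all but one \<open>t\<close>, so density covers the matrices \<open>g\<close> with pivot zero;
  iterated over the columns, this is the density of the big cell.\<close>

lemma vanishes_if_on_upper_triangular: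
  fixes f :: "'k::alg_closed_field mat \<Rightarrow> 'k"
  assumes f: "f \<in> costandard n lam"
    and van: "\<And>g. g \<in> GL n \<Longrightarrow> upper_triangular g \<Longrightarrow> f g = 0"
    and "g \<in> GL n"
  shows "f g = 0"
proof -
  have "\<forall>g\<in>GL n. (\<forall>b<c. \<forall>a<n. b < a \<longrightarrow> g $$ (a, b) = 0) \<longrightarrow> f g = 0" if "c \<le> n" for c
    using that
  proof (induction c rule: inc_induct)
    case base
    show ?case
    proof (intro ballI impI)
      fix g :: "'k mat" assume g: "g \<in> GL n" "\<forall>b<n. \<forall>a<n. b < a \<longrightarrow> g $$ (a, b) = 0"
      then show "f g = 0" by (intro van) (auto simp: GL_def)
    qed
  next
    case (step c)
    have pivot: "f g = 0"
      if g: "g \<in> GL n" and z: "\<forall>b<c. \<forall>a<n. b < a \<longrightarrow> g $$ (a, b) = 0" and p: "g $$ (c, c) \<noteq> 0" for g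
    proof -
      have gc: "g \<in> carrier_mat n n" using g by (rule GL_carrier)
      define l where "l a = (if c < a then - g $$ (a, c) / g $$ (c, c) else 0)" for a
      define L where "L = mat n n (\<lambda>(a, b). (if a = b then 1 else 0) + (if b = c then l a else 0))"
      have L: "L \<in> lower_borel n"
        by (rule lower_borelI) (auto simp: L_def l_def)
      have char: "borel_char n lam L = 1"
        unfolding borel_char_def by (rule prod.neutral) (auto simp: L_def l_def)
      have entry: "(L * g) $$ (a, b) = g $$ (a, b) + l a * g $$ (c, b)" if "a < n" "b < n" for a b
      proof -
        have "(L * g) $$ (a, b) = (\<Sum>k = 0..<n. ((if a = k then 1 else 0) + (if k = c then l a else 0)) * g $$ (k, b))"
          using that gc by (auto simp: L_def scalar_prod_def intro!: sum.cong)
        also have "\<dots> = (\<Sum>k = 0..<n. (if a = k then g $$ (k, b) else 0) + (if k = c then l a * g $$ (k, b) else 0))"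
          by (rule sum.cong) (auto simp: distrib_right)
        also have "\<dots> = g $$ (a, b) + l a * g $$ (c, b)"
          using that step.hyps by (simp add: sum.distrib)
        finally show ?thesis .
      qed
      have "f (L * g) = 0"
      proof (rule step.IH[rule_format])
        show "L * g \<in> GL n" by (rule GL_mult[OF lower_borel_GL[OF L] g])
        fix b a assume "b < Suc c" "a < n" "b < a"
        then show "(L * g) $$ (a, b) = 0"
          using z p step.hyps by (cases "b = c") (auto simp: entry l_def)
      qed
      then show ?thesis using costandardD(2)[OF f L g] char by simp
    qed
    show ?case
    proof (intro ballI impI)
      fix g :: "'k mat" assume g: "g \<in> GL n" and z: "\<forall>b<c. \<forall>a<n. b < a \<longrightarrow> g $$ (a, b) = 0"
      have gc: "g \<in> carrier_mat n n" using g by (rule GL_carrier)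
      define M where "M t = mat n n (\<lambda>(a, b). g $$ (a, b) + (if a = b then t else 0))" for t
      have M0: "M 0 = g" by (rule eq_matI) (use gc in \<open>auto simp: M_def\<close>)
      have "f (M 0) = 0"
      proof (rule vanishes_along_curve[OF costandardD(1)[OF f]])
        show "polynomial_curve n M" unfolding polynomial_curve_def
        proof (intro conjI allI impI)
          fix a b assume "a < n" "b < n"
          then show "polynomial_fun (\<lambda>t. M t $$ (a, b))"
            by (cases "a = b") (auto simp: M_def intro!: polynomial_fun_intros)
        qed (simp add: M_def)
        show "finite {- g $$ (c, c)}" by simp
        show "M 0 \<in> GL n" using M0 g by simp
        fix t assume "t \<notin> {- g $$ (c, c)}" "M t \<in> GL n"
        then show "f (M t) = 0"
          using z step.hyps
          by (intro pivot) (auto simp: M_def eq_neg_iff_add_eq_0 add.commute)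
      qed
      then show "f g = 0" using M0 by simp
    qed
  qed
  from this[of 0] show ?thesis using assms(3) by simp
qed

definition unitriangular :: "nat \<Rightarrow> 'k::field mat \<Rightarrow> bool" where
  "unitriangular n u \<longleftrightarrow> u \<in> carrier_mat n n \<and> (\<forall>a<n. u $$ (a, a) = 1) \<and> (\<forall>b<n. \<forall>a<n. b < a \<longrightarrow> u $$ (a, b) = 0)"

lemma det_upper_triangular_prod:
  assumes "g \<in> carrier_mat n n" and "\<And>a b. b < a \<Longrightarrow> a < n \<Longrightarrow> g $$ (a, b) = 0"
  shows "det g = (\<Prod>a = 0..<n. g $$ (a, a))"
  using det_upper_triangular[of g n] assms by (auto simp: prod_list_diag_prod)

lemma unitriangular_GL: "unitriangular n u \<Longrightarrow> u \<in> GL n"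
  using det_upper_triangular_prod[of u n] by (auto simp: unitriangular_def GL_def)

lemma vanishes_if_on_unitriangular:
  fixes f :: "'k::alg_closed_field mat \<Rightarrow> 'k"
  assumes f: "f \<in> costandard n lam"
    and van: "\<And>u. unitriangular n u \<Longrightarrow> f u = 0"
    and "g \<in> GL n"
  shows "f g = 0"
proof (rule vanishes_if_on_upper_triangular[OF f _ assms(3)])
  fix g :: "'k mat" assume g: "g \<in> GL n" and ut: "upper_triangular g"
  have gc: "g \<in> carrier_mat n n" using g by (rule GL_carrier)
  have "det g \<noteq> 0" using g by (simp add: GL_def)
  then have nz: "g $$ (a, a) \<noteq> 0" if "a < n" for a
    using det_upper_triangular_prod[OF gc] ut gc that by (auto simp: upper_triangular_def)
  define D where "D = mat n n (\<lambda>(a, b). if a = b then inverse (g $$ (a, a)) else 0)"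
  have Dc: "D \<in> carrier_mat n n" by (simp add: D_def)
  have D: "D \<in> lower_borel n" by (rule lower_borelI) (use nz in \<open>auto simp: D_def\<close>)
  have entry: "(D * g) $$ (a, b) = inverse (g $$ (a, a)) * g $$ (a, b)" if "a < n" "b < n" for a b
  proof -
    have "(D * g) $$ (a, b) = (\<Sum>k = 0..<n. if a = k then inverse (g $$ (a, a)) * g $$ (k, b) else 0)"
      using that gc by (simp add: D_def scalar_prod_def mult_delta_left)
    then show ?thesis using that by simp
  qed
  have "unitriangular n (D * g)"
    using ut gc nz mult_carrier_mat[OF Dc gc] by (auto simp: unitriangular_def entry upper_triangular_def)
  then have "f (D * g) = 0" by (rule van)
  moreover have "borel_char n lam D \<noteq> 0"
    using nz by (auto simp: borel_char_def D_def power_int_eq_0_iff)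
  ultimately show "f g = 0" using costandardD(2)[OF f D g] by simp
qed

text \<open>Invariance under the simple root subgroups of the upper left \<open>GL(n-1)\<close>.\<close>

definition unipotent_invariant :: "nat \<Rightarrow> ('k::field mat \<Rightarrow> 'k) \<Rightarrow> bool" where
  "unipotent_invariant n f \<longleftrightarrow>
     (\<forall>l t. \<forall>g\<in>GL n. l + 2 < n \<longrightarrow> f (g * elem_mat n (Suc l) (Suc (Suc l)) t) = f g)"

text \<open>The non-simple root subgroups are generated by commutators of those for shorter roots.\<close>

lemma unipotent_invariant_root:
  assumes f: "unipotent_invariant n f" and "k < m" and "Suc m < n" and "g \<in> GL n"
  shows "f (g * elem_mat n (Suc k) (Suc m) t) = f g"
  using assms(2-4)
proof (induction m arbitrary: k g t)
  case (Suc m)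
  have simple: "f (g * elem_mat n (Suc m) (Suc (Suc m)) t) = f g" if "g \<in> GL n" for g t
    using f Suc.prems that unfolding unipotent_invariant_def by auto
  show ?case
  proof (cases "k = m")
    case True
    then show ?thesis using simple Suc.prems by simp
  next
    case False
    then have km: "k < m" "Suc m < n" "m < n" "k < n" using Suc.prems by auto
    have IH: "f (g * elem_mat n (Suc k) (Suc m) t) = f g" if "g \<in> GL n" for g t
      using Suc.IH km that by simp
    have gc: "g \<in> carrier_mat n n" using Suc.prems by (simp add: GL_carrier)
    let ?x = "\<lambda>t. elem_mat n (Suc k) (Suc m) t" and ?y = "\<lambda>t. elem_mat n (Suc m) (Suc (Suc m)) t"
    have GL: "h * ?x t \<in> GL n" "h * ?y t \<in> GL n" if "h \<in> GL n" for h t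
      using that km by (auto intro!: GL_mult elem_mat_GL)
    \<comment> \<open>The commutator of \<open>1 + t X\<^sub>k\<^sub>m\<close> and \<open>1 + X\<^sub>m\<^sub>,\<^sub>m\<^sub>+\<^sub>1\<close> is \<open>1 + t X\<^sub>k\<^sub>,\<^sub>m\<^sub>+\<^sub>1\<close>.\<close>
    have "g * elem_mat n (Suc k) (Suc (Suc m)) t = g * ?x t * ?y 1 * ?x (- t) * ?y (- 1)"
    proof (rule eq_matI)
      fix a b assume "a < dim_row (g * ?x t * ?y 1 * ?x (- t) * ?y (- 1))"
        "b < dim_col (g * ?x t * ?y 1 * ?x (- t) * ?y (- 1))"
      then have ab: "a < n" "b < n" using gc by auto
      have c: "h * elem_mat n i j s \<in> carrier_mat n n" if "h \<in> carrier_mat n n" for h :: "'a mat" and i j s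
        using that by simp
      have ne: "k \<noteq> m" "m \<noteq> k" "k \<noteq> Suc m" "Suc m \<noteq> k" using km by auto
      show "(g * elem_mat n (Suc k) (Suc (Suc m)) t) $$ (a, b) = (g * ?x t * ?y 1 * ?x (- t) * ?y (- 1)) $$ (a, b)"
        using ab km gc ne by (cases "b = m"; cases "b = Suc m")
          (simp_all add: mult_elem_mat c algebra_simps del: index_mult_mat elem_mat_carrier)
    qed (use gc in auto)
    then have "f (g * elem_mat n (Suc k) (Suc (Suc m)) t) = f (g * ?x t * ?y 1 * ?x (- t) * ?y (- 1))" by simp
    also have "\<dots> = f (g * ?x t * ?y 1 * ?x (- t))" by (intro simple GL Suc.prems)
    also have "\<dots> = f (g * ?x t * ?y 1)" by (intro IH GL Suc.prems)
    also have "\<dots> = f (g * ?x t)" by (intro simple GL Suc.prems)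
    also have "\<dots> = f g" by (intro IH Suc.prems)
    finally show ?thesis .
  qed
qed simp

definition last_column_mat :: "nat \<Rightarrow> (nat \<Rightarrow> 'k::field) \<Rightarrow> 'k mat" where
  "last_column_mat n c = mat n n (\<lambda>(a, b). if a = b then 1 else if Suc b = n then c a else 0)"

lemma last_column_mat_unitriangular: "unitriangular n (last_column_mat n c)"
  by (auto simp: unitriangular_def last_column_mat_def)

text \<open>Column operations clear all columns but the last. If \<open>m\<close> is the leftmost column with a non-zero entry
  above the diagonal, the columns before it are unit vectors, so clearing one entry of column \<open>m\<close>
  affects no other entry and the number of non-zero entries drops.\<close>

lemma unipotent_invariant_last_column:
  assumes f: "unipotent_invariant n f" and u: "unitriangular n u"
  shows "f u = f (last_column_mat n (\<lambda>a. u $$ (a, n - 1)))"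
  using u
proof (induction "card {(a, b). a < b \<and> Suc b < n \<and> u $$ (a, b) \<noteq> 0}" arbitrary: u rule: less_induct)
  case less
  let ?N = "\<lambda>u. {(a, b). a < b \<and> Suc b < n \<and> u $$ (a, b) \<noteq> 0}"
  have fin: "finite (?N u)" for u :: "'a mat"
    by (rule finite_subset[of _ "{..<n} \<times> {..<n}"]) auto
  have uc: "u \<in> carrier_mat n n" using less.prems by (simp add: unitriangular_def)
  show ?case
  proof (cases "?N u = {}")
    case True
    have "u = last_column_mat n (\<lambda>a. u $$ (a, n - 1))"
    proof (rule eq_matI)
      fix a b assume "a < dim_row (last_column_mat n (\<lambda>a. u $$ (a, n - 1)))"
        "b < dim_col (last_column_mat n (\<lambda>a. u $$ (a, n - 1)))"
      then have ab: "a < n" "b < n" by (auto simp: last_column_mat_def)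
      have "u $$ (a, b) = 0" if "a < b" "Suc b \<noteq> n" using True that ab by auto
      moreover have "Suc b = n \<Longrightarrow> n - 1 = b" by simp
      ultimately show "u $$ (a, b) = last_column_mat n (\<lambda>a. u $$ (a, n - 1)) $$ (a, b)"
        using ab less.prems by (cases a b rule: linorder_cases) (auto simp: last_column_mat_def unitriangular_def)
    qed (use uc in \<open>auto simp: last_column_mat_def\<close>)
    then show ?thesis by simp
  next
    case False
    define m where "m = (LEAST b. \<exists>a. (a, b) \<in> ?N u)"
    have "\<exists>a. (a, m) \<in> ?N u" unfolding m_def by (rule LeastI_ex) (use False in auto)
    then obtain k where k: "k < m" "Suc m < n" "u $$ (k, m) \<noteq> 0" by auto
    have col: "u $$ (a, k) = (if a = k then 1 else 0)" if "a < n" for a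
    proof (cases a k rule: linorder_cases)
      case less
      have "(a, k) \<notin> ?N u" using not_less_Least[of k "\<lambda>b. \<exists>a. (a, b) \<in> ?N u"] k(1) unfolding m_def by blast
      then show ?thesis using less k by auto
    qed (use less.prems that k in \<open>auto simp: unitriangular_def\<close>)
    define u' where "u' = u * elem_mat n (Suc k) (Suc m) (- u $$ (k, m))"
    have entry: "u' $$ (a, b) = (if a = k \<and> b = m then 0 else u $$ (a, b))" if "a < n" "b < n" for a b
      unfolding u'_def using that k uc by (subst mult_elem_mat) (auto simp: col)
    have u': "unitriangular n u'"
      unfolding unitriangular_def
    proof (intro conjI allI impI)
      show "u' \<in> carrier_mat n n" unfolding u'_def using uc by simp
    qed (use less.prems k in \<open>auto simp: entry unitriangular_def\<close>)
    have "?N u' \<subset> ?N u"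
    proof
      show "?N u' \<subseteq> ?N u" by (auto simp: entry split: if_splits)
      have "(k, m) \<in> ?N u" "(k, m) \<notin> ?N u'" using k by (auto simp: entry)
      then show "?N u' \<noteq> ?N u" by metis
    qed
    then have "f u' = f (last_column_mat n (\<lambda>a. u' $$ (a, n - 1)))"
      by (intro less.hyps u' psubset_card_mono fin)
    moreover have "last_column_mat n (\<lambda>a. u' $$ (a, n - 1)) = last_column_mat n (\<lambda>a. u $$ (a, n - 1))"
      by (rule eq_matI) (use k in \<open>auto simp: last_column_mat_def entry\<close>)
    moreover have "f u' = f u"
      unfolding u'_def using k by (intro unipotent_invariant_root[OF f] unitriangular_GL less.prems) auto
    ultimately show ?thesis by simp
  qed
qed

definition torus_eigenvector :: "nat \<Rightarrow> (nat \<Rightarrow> int) \<Rightarrow> ('k::field mat \<Rightarrow> 'k) \<Rightarrow> bool" where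
  "torus_eigenvector n \<nu> f \<longleftrightarrow>
     (\<forall>k t. \<forall>g\<in>GL n. Suc k < n \<longrightarrow> t \<noteq> - 1 \<longrightarrow>
        f (g * elem_mat n (Suc k) (Suc k) t) = (1 + t) powi \<nu> (Suc k) * f g)"

text \<open>A diagonal matrix moved from the right to the left of \<open>1 + c\<close> rescales an entry of \<open>c\<close>. On the right it
  acts by the weight \<open>\<nu>\<close>, on the left by \<open>lam\<close>, whence the difference in the exponent.\<close>

lemma scale_last_column:
  assumes f: "f \<in> costandard n lam" and tor: "torus_eigenvector n \<nu> f" and k: "Suc k < n" and z: "z \<noteq> 0"
  shows "f (last_column_mat n (c(k := z * c k))) =
    z powi (lam (Suc k) - \<nu> (Suc k)) * f (last_column_mat n c)"
proof -
  define t where "t = inverse z - 1"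
  have t: "t \<noteq> - 1" "1 + t = inverse z" using z by (auto simp: t_def)
  let ?d = "elem_mat n (Suc k) (Suc k) t" and ?c = "c(k := z * c k)"
  have [simp]: "last_column_mat n c \<in> carrier_mat n n" for c :: "nat \<Rightarrow> 'a"
    by (simp add: last_column_mat_def)
  have L: "last_column_mat n c \<in> GL n" for c :: "nat \<Rightarrow> 'a"
    using last_column_mat_unitriangular unitriangular_GL by blast
  have "last_column_mat n c * ?d = ?d * last_column_mat n ?c"
  proof (rule eq_matI)
    fix a b assume "a < dim_row (?d * last_column_mat n ?c)" "b < dim_col (?d * last_column_mat n ?c)"
    then have ab: "a < n" "b < n" by (auto simp: last_column_mat_def)
    have "z * c k + t * (z * c k) = (1 + t) * z * c k" by (simp add: algebra_simps)
    then have "z * c k + t * (z * c k) = c k" using t z by simp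
    moreover have "(last_column_mat n c * ?d) $$ (a, b) =
        last_column_mat n c $$ (a, b) + (if b = k then t * last_column_mat n c $$ (a, k) else 0)"
      using ab k by (intro mult_elem_mat) auto
    moreover have "(?d * last_column_mat n ?c) $$ (a, b) =
        last_column_mat n ?c $$ (a, b) + (if a = k then t * last_column_mat n ?c $$ (k, b) else 0)"
      using ab k by (intro elem_mat_mult) auto
    ultimately show "(last_column_mat n c * ?d) $$ (a, b) = (?d * last_column_mat n ?c) $$ (a, b)"
      using ab k by (auto simp: last_column_mat_def)
  qed (auto simp: last_column_mat_def)
  then have "f (last_column_mat n c * ?d) = f (?d * last_column_mat n ?c)" by simp
  moreover have "f (last_column_mat n c * ?d) = inverse z powi \<nu> (Suc k) * f (last_column_mat n c)"
    using tor L k t unfolding torus_eigenvector_def by metis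
  moreover have "f (?d * last_column_mat n ?c) = inverse z powi lam (Suc k) * f (last_column_mat n ?c)"
    using costandardD(2)[OF f elem_mat_diagonal_borel(1) L] elem_mat_diagonal_borel(2)[of k n t lam] k t
    by simp
  ultimately show ?thesis
    using z by (simp add: power_int_diff power_int_inverse field_simps)
qed

text \<open>An invariant function is determined by its value at one point: columns without zero entries are
  reached from the column of ones by rescaling, all others from these by density.\<close>

lemma vanishes_if_at_ones:
  fixes f :: "'k::alg_closed_field mat \<Rightarrow> 'k"
  assumes f: "f \<in> costandard n lam" and inv: "unipotent_invariant n f" and tor: "torus_eigenvector n \<nu> f"
    and one: "f (last_column_mat n (\<lambda>_. 1)) = 0"
  shows "f = (\<lambda>_. 0)"
proof (rule costandard_eqI[OF f], rule vanishes_if_on_unitriangular[OF f])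
  have cong: "last_column_mat n c = last_column_mat n d" if "\<And>a. Suc a < n \<Longrightarrow> c a = d a" for c d :: "nat \<Rightarrow> 'k"
    by (rule eq_matI) (use that in \<open>auto simp: last_column_mat_def\<close>)
  have nonzero: "f (last_column_mat n c) = 0" if c: "\<And>a. a < n \<Longrightarrow> c a \<noteq> 0" for c
  proof -
    \<comment> \<open>The entries of the column are rescaled one at a time.\<close>
    have ind: "f (last_column_mat n (\<lambda>a. if a < m then c a else 1)) = 0" if "m < n" for m
      using that
    proof (induction m)
      case (Suc m)
      have "(\<lambda>a. if a < Suc m then c a else 1) = (\<lambda>a. if a < m then c a else 1)(m := c m * (if m < m then c m else 1))"
        by (auto simp: less_Suc_eq)
      then show ?case
        using scale_last_column[OF f tor Suc.prems c[of m], of "\<lambda>a. if a < m then c a else 1"] Suc by simp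
    qed (simp add: one)
    have "last_column_mat n (\<lambda>a. if a < n - 1 then c a else 1) = last_column_mat n c"
      by (rule cong) auto
    then have "n \<noteq> 0 \<Longrightarrow> ?thesis" using ind[of "n - 1"] by simp
    moreover have "n = 0 \<Longrightarrow> ?thesis" using one cong[of c "\<lambda>_. 1"] by simp
    ultimately show ?thesis by blast
  qed
  fix u :: "'k mat" assume "unitriangular n u"
  then have u: "f u = f (last_column_mat n (\<lambda>a. u $$ (a, n - 1)))"
    by (rule unipotent_invariant_last_column[OF inv])
  let ?M = "\<lambda>z. last_column_mat n (\<lambda>a. u $$ (a, n - 1) + z)"
  have "f (?M 0) = 0"
  proof (rule vanishes_along_curve[OF costandardD(1)[OF f], where M = ?M])
    show "polynomial_curve n ?M" unfolding polynomial_curve_def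
    proof (intro conjI allI impI)
      fix a b assume "a < n" "b < n"
      then show "polynomial_fun (\<lambda>t. ?M t $$ (a, b))"
        by (cases "a = b"; cases "Suc b = n") (auto simp: last_column_mat_def intro!: polynomial_fun_intros)
    qed (simp add: last_column_mat_def)
    \<comment> \<open>For every other \<open>z\<close> the shifted column has no zero entry.\<close>
    show "finite ((\<lambda>a. - u $$ (a, n - 1)) ` {..<n})" by simp
    show "?M 0 \<in> GL n" using last_column_mat_unitriangular unitriangular_GL by blast
    fix z assume "z \<notin> (\<lambda>a. - u $$ (a, n - 1)) ` {..<n}"
    then show "f (?M z) = 0"
      by (intro nonzero) (auto simp: eq_neg_iff_add_eq_0 add.commute image_iff)
  qed
  then show "f u = 0" using u by simp
qed

section \<open>The hyperalgebra and high weight vectors\<close>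

lemma pure_tensor_carrier:
  assumes "ring R" "a \<in> carrier R"
  shows "pure_tensor R a (c :: 'k::field) \<in> carrier (tensor_field R)"
proof -
  have "Poly_Mapping.single a c \<in> carrier (monoid_algebra R)"
    using assms(2) by (auto simp: monoid_algebra_def)
  then show ?thesis
    unfolding tensor_field_def FactRing_def pure_tensor_def A_RCOSETS_def' by auto
qed

lemma kostant_generators:
  assumes "i \<in> {1..n}" "1 \<le> r"
  shows "j \<in> {1..n} \<Longrightarrow> i \<noteq> j \<Longrightarrow> div_power n i j r \<in> carrier (kostant_form n)"
    and "binom_diag n i r \<in> carrier (kostant_form n)"
  using assms unfolding kostant_form_def by (auto intro!: generate_ring.incl)

lemma hyperalgebra_generators:
  assumes "i \<in> {1..n}" "1 \<le> r"
  shows "j \<in> {1..n} \<Longrightarrow> i \<noteq> j \<Longrightarrow> (hE n i j r :: 'k::field hyper) \<in> carrier (hyperalgebra n)"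
    and "j \<in> {1..n} \<Longrightarrow> i \<noteq> j \<Longrightarrow> (hF n i j r :: 'k hyper) \<in> carrier (hyperalgebra n)"
    and "(hH n i r :: 'k hyper) \<in> carrier (hyperalgebra n)"
  unfolding hyperalgebra_def hE_def hF_def hH_def
  using assms by (auto intro!: pure_tensor_carrier kostant_ring kostant_generators)

text \<open>With \<open>A\<close> and \<open>B\<close> empty, \<open>D = {}\<close> is the only summand and its products are empty.\<close>

lemma calH_poly_empty: "calH_poly i {} {} = 1"
proof -
  have "calH i {} {} = Fract 1 1" by (simp add: calH_def One_fract_def)
  then show ?thesis unfolding calH_poly_def by (auto simp: eq_fract)
qed

lemma eval_H_one: "eval_H n 1 = (\<one>\<^bsub>hyperalgebra n\<^esub> :: 'k::field hyper)"
proof -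
  interpret ring "hyperalgebra n :: 'k hyper ring" by (rule hyper_ring)
  have "add_pow (hyperalgebra n) (1 :: int) \<one>\<^bsub>hyperalgebra n\<^esub> = (\<one>\<^bsub>hyperalgebra n\<^esub> :: 'k hyper)"
    using add.int_pow_1[OF one_closed] by simp
  then show ?thesis
    by (simp add: eval_H_def hprod_def finsum_insert)
qed

lemma lowering_op_Suc:
  assumes "1 \<le> i" "i < n"
  shows "lowering_op n i (Suc i) {} = (hF n i (Suc i) 1 :: 'k::field hyper)"
proof -
  interpret ring "hyperalgebra n :: 'k hyper ring" by (rule hyper_ring)
  have F: "(hF n i (Suc i) 1 :: 'k hyper) \<in> carrier (hyperalgebra n)"
    using assms by (intro hyperalgebra_generators) auto
  have "sorted_list_of_set {i, Suc i} = [i, Suc i]"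
    by (subst sorted_list_of_set.sorted_key_list_of_set_insert) auto
  then have "hF_set n i (Suc i) {} = (hF n i (Suc i) 1 :: 'k hyper)"
    using F by (simp add: hF_set_def hprod_def)
  moreover have "{i<..<Suc i} = {}" by auto
  ultimately show ?thesis
    using F by (simp add: lowering_op_def calH_poly_empty eval_H_one finsum_insert)
qed

lemma costandard_actionD:
  assumes "costandard_action n lam act" and "f \<in> costandard n lam"
  shows "u \<in> carrier (hyperalgebra n) \<Longrightarrow> act u f \<in> costandard n lam"
    and "g \<in> GL n \<Longrightarrow> i < j \<Longrightarrow> j < n \<Longrightarrow> 1 \<le> r \<Longrightarrow>
      act (hE n (Suc i) (Suc j) r) f g = expansion_coeff (\<lambda>t. f (g * elem_mat n (Suc i) (Suc j) t)) r"
    and "g \<in> GL n \<Longrightarrow> i < j \<Longrightarrow> j < n \<Longrightarrow> 1 \<le> r \<Longrightarrow>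
      act (hF n (Suc i) (Suc j) r) f g = expansion_coeff (\<lambda>t. f (g * elem_mat n (Suc j) (Suc i) t)) r"
    and "g \<in> GL n \<Longrightarrow> i < n \<Longrightarrow> 1 \<le> r \<Longrightarrow>
      act (hH n (Suc i) r) f g = expansion_coeff (\<lambda>t. f (g * elem_mat n (Suc i) (Suc i) t)) r"
  using assms unfolding costandard_action_def hyper_module_def by auto

lemma elem_mat_zero: "g \<in> carrier_mat n n \<Longrightarrow> i < n \<Longrightarrow> j < n \<Longrightarrow> g * elem_mat n (Suc i) (Suc j) 0 = g"
  by (rule eq_matI) (auto simp: mult_elem_mat simp del: index_mult_mat(1))

lemma raising_expansion:
  fixes act :: "'k::alg_closed_field hyper \<Rightarrow> ('k mat \<Rightarrow> 'k) \<Rightarrow> ('k mat \<Rightarrow> 'k)"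
  assumes "costandard_action n lam act" "f \<in> costandard n lam" "g \<in> GL n" "i < j" "j < n"
    and "\<And>t. f (g * elem_mat n (Suc i) (Suc j) t) = poly P t" and "1 \<le> r"
  shows "act (hE n (Suc i) (Suc j) r) f g = poly.coeff P r"
  using expansion_coeff_poly[OF assms(6)] costandard_actionD(2)[OF assms(1-5,7)] by simp

text \<open>The weight of \<open>f\<close> prescribes the expansion of \<open>t \<mapsto> f (g (1 + t X\<^sub>k\<^sub>k))\<close> as a binomial series. As this
  function has no pole other than \<open>-1\<close>, the expansion determines it.\<close>

lemma weight_iff_torus_eigenvector:
  fixes act :: "'k::alg_closed_field hyper \<Rightarrow> ('k mat \<Rightarrow> 'k) \<Rightarrow> ('k mat \<Rightarrow> 'k)"
  assumes act: "costandard_action n lam act" and f: "f \<in> costandard n lam"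
  shows "has_weight n (n - 1) act \<nu> f \<longleftrightarrow> torus_eigenvector n \<nu> f"
proof
  assume w: "has_weight n (n - 1) act \<nu> f"
  show "torus_eigenvector n \<nu> f" unfolding torus_eigenvector_def
  proof (intro allI ballI impI)
    fix k and t :: 'k and g :: "'k mat" assume g: "g \<in> GL n" and k: "Suc k < n" and t: "t \<noteq> - 1"
    let ?\<phi> = "\<lambda>t. f (g * elem_mat n (Suc k) (Suc k) t)"
    have reg: "regular_off_minus_1 ?\<phi>"
      using costandardD(1)[OF f] g k by (intro elem_mat_diagonal_regular) auto
    then obtain F where F: "has_expansion ?\<phi> F" using has_expansion_exists by blast
    have "fps_nth F r = fps_nth (binomial_fps (\<nu> (Suc k)) * fps_const (f g)) r" for r
    proof (cases "r = 0")
      case True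
      then show ?thesis using has_expansion_nth_0[OF F] elem_mat_zero[OF GL_carrier[OF g], of k k] k
        by (simp add: binomial_fps_0)
    next
      case False
      then have "fps_nth F r = act (hH n (Suc k) r) f g"
        using expansion_coeff_eq_nth[OF reg F] costandard_actionD(4)[OF act f g, of k r] k by simp
      also have "\<dots> = of_int (int_binom (\<nu> (Suc k)) r) * f g"
        using w k False unfolding has_weight_def by auto
      finally show ?thesis by (simp add: binomial_fps_nth)
    qed
    then have "F = binomial_fps (\<nu> (Suc k)) * fps_const (f g)" by (simp add: fps_eq_iff)
    then have "has_expansion (\<lambda>t. (1 + t) powi \<nu> (Suc k) * f g) F"
      using has_expansion_mult[OF powi_has_expansion has_expansion_const] by simp
    from regular_off_minus_1_eqI[OF reg powi_regular F this t]
    show "f (g * elem_mat n (Suc k) (Suc k) t) = (1 + t) powi \<nu> (Suc k) * f g" .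
  qed
next
  assume tor: "torus_eigenvector n \<nu> f"
  have "act (hH n (Suc k) r) f g = of_int (int_binom (\<nu> (Suc k)) r) * f g" if k: "Suc k < n" and r: "1 \<le> r" for k r g
  proof (cases "g \<in> GL n")
    case True
    let ?\<phi> = "\<lambda>t. f (g * elem_mat n (Suc k) (Suc k) t)"
    have "regular_off_minus_1 ?\<phi>"
      using costandardD(1)[OF f] True k by (intro elem_mat_diagonal_regular) auto
    moreover have "has_expansion ?\<phi> (binomial_fps (\<nu> (Suc k)) * fps_const (f g))"
    proof (rule has_expansion_cong[OF has_expansion_mult[OF powi_has_expansion has_expansion_const]])
      fix s :: 'k assume "poly [:1, 1:] s \<noteq> 0"
      then have "s \<noteq> - 1" by auto
      then show "(1 + s) powi \<nu> (Suc k) * f g = ?\<phi> s"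
        using tor k True unfolding torus_eigenvector_def by simp
    qed simp
    ultimately have "expansion_coeff ?\<phi> r = fps_nth (binomial_fps (\<nu> (Suc k)) * fps_const (f g)) r"
      by (rule expansion_coeff_eq_nth)
    then show ?thesis using costandard_actionD(4)[OF act f True, of k r] k r by (simp add: binomial_fps_nth)
  next
    case False
    have "act (hH n (Suc k) r) f \<in> costandard n lam"
      using k r by (intro costandard_actionD(1)[OF act f] hyperalgebra_generators) auto
    then show ?thesis using f False unfolding costandard_def coordinate_ring_def by auto
  qed
  then show "has_weight n (n - 1) act \<nu> f"
    unfolding has_weight_def by (auto simp: fun_eq_iff Suc_le_eq gr0_conv_Suc)
qed

text \<open>The function \<open>t \<mapsto> f (g (1 + t X))\<close> is polynomial for \<open>X\<close> a simple root vector, and the divided powers of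
  \<open>X\<close> give its coefficients; they annihilate \<open>f\<close> exactly if the polynomials are constant. This
  requires all divided powers, since in characteristic \<open>p\<close> the first derivative does not detect
  non-constancy.\<close>

lemma high_weight_iff_invariant:
  fixes act :: "'k::alg_closed_field hyper \<Rightarrow> ('k mat \<Rightarrow> 'k) \<Rightarrow> ('k mat \<Rightarrow> 'k)"
  assumes act: "costandard_action n lam act" and f: "f \<in> costandard n lam"
  shows "high_weight_vector n (n - 1) act \<nu> f \<longleftrightarrow> torus_eigenvector n \<nu> f \<and> unipotent_invariant n f"
proof -
  have "(\<forall>i\<in>{1..<n - 1}. \<forall>r\<ge>1. act (hE n i (Suc i) r) f = (\<lambda>_. 0)) \<longleftrightarrow> unipotent_invariant n f"
  proof
    assume E: "\<forall>i\<in>{1..<n - 1}. \<forall>r\<ge>1. act (hE n i (Suc i) r) f = (\<lambda>_. 0)"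
    show "unipotent_invariant n f" unfolding unipotent_invariant_def
    proof (intro allI ballI impI)
      fix l and t :: 'k and g :: "'k mat" assume g: "g \<in> GL n" and l: "l + 2 < n"
      obtain P where P: "\<And>t. f (g * elem_mat n (Suc l) (Suc (Suc l)) t) = poly P t"
        using elem_mat_off_diagonal_polynomial[OF costandardD(1)[OF f] g, of l "Suc l"] l by auto
      have "poly.coeff P r = 0" if "1 \<le> r" for r
        using raising_expansion[OF act f g, of l "Suc l" P r] P l E that by simp
      then have "degree P = 0" by (metis One_nat_def Suc_leI leading_coeff_0_iff neq0_conv degree_0)
      then obtain c where "P = [:c:]" by (rule degree_eq_zeroE)
      then have "poly P t = poly P 0" by simp
      then show "f (g * elem_mat n (Suc l) (Suc (Suc l)) t) = f g"
        using elem_mat_zero[OF GL_carrier[OF g], of l "Suc l"] l by (simp flip: P)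
    qed
  next
    assume inv: "unipotent_invariant n f"
    have "act (hE n (Suc l) (Suc (Suc l)) r) f = (\<lambda>_. 0)" if l: "l + 2 < n" and r: "1 \<le> r" for l r
    proof (rule costandard_eqI)
      show "act (hE n (Suc l) (Suc (Suc l)) r) f \<in> costandard n lam"
        using l r by (intro costandard_actionD(1)[OF act f] hyperalgebra_generators) auto
      fix g :: "'k mat" assume g: "g \<in> GL n"
      have "f (g * elem_mat n (Suc l) (Suc (Suc l)) t) = poly [:f g:] t" for t
        using inv g l unfolding unipotent_invariant_def by simp
      then show "act (hE n (Suc l) (Suc (Suc l)) r) f g = 0"
        using raising_expansion[OF act f g, of l "Suc l" "[:f g:]" r] l r
        by (cases r) auto
    qed
    then show "\<forall>i\<in>{1..<n - 1}. \<forall>r\<ge>1. act (hE n i (Suc i) r) f = (\<lambda>_. 0)"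
      by (auto simp: Suc_le_eq gr0_conv_Suc)
  qed
  then show ?thesis
    unfolding high_weight_vector_def weight_iff_torus_eigenvector[OF act f] by blast
qed

section \<open>The lowering operator of a simple root\<close>

text \<open>Let \<open>y(s)\<close> be the root subgroup of \<open>F\<^sub>i\<close>. If \<open>f (g' y(s)) = \<chi>(s) f (g y(\<sigma>(s)))\<close>, then the product and chain rules compare the derivatives at
  \<open>s = 0\<close>. All values of \<open>F\<^sub>i f\<close> below come from such an identity.\<close>

lemma lowering_twist:
  fixes act :: "'k::alg_closed_field hyper \<Rightarrow> ('k mat \<Rightarrow> 'k) \<Rightarrow> ('k mat \<Rightarrow> 'k)"
  assumes act: "costandard_action n lam act" and f: "f \<in> costandard n lam" and i: "Suc i < n"
    and g: "g \<in> GL n" "g' \<in> GL n"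
    and \<chi>: "has_expansion \<chi> X" and \<sigma>: "has_expansion \<sigma> S" "fps_nth S 0 = 0" and C: "poly C 0 \<noteq> 0"
    and eq: "\<And>s. poly C s \<noteq> 0 \<Longrightarrow>
      f (g' * elem_mat n (Suc (Suc i)) (Suc i) s) = \<chi> s * f (g * elem_mat n (Suc (Suc i)) (Suc i) (\<sigma> s))"
  shows "act (hF n (Suc i) (Suc (Suc i)) 1) f g' =
    fps_nth X 0 * fps_nth S 1 * act (hF n (Suc i) (Suc (Suc i)) 1) f g + fps_nth X 1 * f g"
proof -
  have ex: "\<exists>P. \<forall>s. f (h * elem_mat n (Suc (Suc i)) (Suc i) s) = poly P s" if "h \<in> GL n" for h
    using elem_mat_off_diagonal_polynomial[OF costandardD(1)[OF f] that, of "Suc i" i] i by auto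
  obtain P where P: "\<And>s. f (g * elem_mat n (Suc (Suc i)) (Suc i) s) = poly P s" using ex[OF g(1)] by blast
  obtain P' where P': "\<And>s. f (g' * elem_mat n (Suc (Suc i)) (Suc i) s) = poly P' s" using ex[OF g(2)] by blast
  have F: "act (hF n (Suc i) (Suc (Suc i)) 1) f g = poly.coeff P 1"
    "act (hF n (Suc i) (Suc (Suc i)) 1) f g' = poly.coeff P' 1"
    using costandard_actionD(3)[OF act f _ _ i, of _ i 1] g expansion_coeff_poly[OF P] expansion_coeff_poly[OF P']
    by simp_all
  have P0: "poly.coeff P 0 = f g"
    using elem_mat_zero[OF GL_carrier[OF g(1)], of "Suc i" i] i P[of 0] by (simp add: poly_0_coeff_0)
  obtain G where G: "has_expansion (\<lambda>s. poly P (\<sigma> s)) G" "fps_nth G 0 = poly.coeff P 0"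
    "fps_nth G 1 = poly.coeff P 1 * fps_nth S 1"
    using has_expansion_poly_compose[OF \<sigma>] by blast
  have "has_expansion (poly P') (X * G)"
    by (rule has_expansion_cong[OF has_expansion_mult[OF \<chi> G(1)] C]) (use eq P P' in auto)
  then have "fps_of_poly P' = X * G" using has_expansion_unique[OF has_expansion_poly] by blast
  then have "poly.coeff P' 1 = fps_nth (X * G) 1" by (metis fps_of_poly_nth)
  then show ?thesis by (simp add: F fps_mult_nth_1 G P0 mult_ac del: One_nat_def)
qed

text \<open>The row operation \<open>y(s)\<close> compensates the column operation \<open>y(s)\<close> except in the last column, where the
  entry in row \<open>i + 1\<close> becomes \<open>1 - s\<close>. Hence \<open>f\<close> is \<open>(1 - s)\<^sup>b\<close> times its value at \<open>s = 0\<close>, with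
  \<open>b = \<lambda>\<^sub>i\<^sub>+\<^sub>1 - \<nu>\<^sub>i\<^sub>+\<^sub>1\<close> for indices counted from \<open>1\<close>.\<close>

lemma lowering_at_ones:
  fixes act :: "'k::alg_closed_field hyper \<Rightarrow> ('k mat \<Rightarrow> 'k) \<Rightarrow> ('k mat \<Rightarrow> 'k)"
  assumes act: "costandard_action n lam act" and f: "f \<in> costandard n lam" and i: "i + 2 < n"
    and tor: "torus_eigenvector n \<nu> f"
  shows "act (hF n (Suc i) (Suc (Suc i)) 1) f (last_column_mat n (\<lambda>_. 1)) =
    - of_int (lam (i + 2) - \<nu> (i + 2)) * f (last_column_mat n (\<lambda>_. 1))"
proof -
  let ?y = "elem_mat n (Suc (Suc i)) (Suc i)" and ?v = "last_column_mat n (\<lambda>_. 1 :: 'k)"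
  have L: "last_column_mat n c \<in> GL n" for c :: "nat \<Rightarrow> 'k"
    using last_column_mat_unitriangular unitriangular_GL by blast
  have y0: "?v * ?y 0 = ?v" using i by (intro elem_mat_zero GL_carrier L) auto
  have shift: "?v * ?y s = ?y s * last_column_mat n ((\<lambda>_. 1)(Suc i := (1 - s) * 1))" for s
  proof (rule eq_matI)
    let ?w = "last_column_mat n ((\<lambda>_. 1)(Suc i := (1 - s) * 1))"
    fix a b assume "a < dim_row (?y s * ?w)" "b < dim_col (?y s * ?w)"
    then have ab: "a < n" "b < n" by (auto simp: last_column_mat_def)
    have "(?v * ?y s) $$ (a, b) = ?v $$ (a, b) + (if b = i then s * ?v $$ (a, Suc i) else 0)"
      using ab i L by (intro mult_elem_mat GL_carrier) auto
    moreover have "(?y s * ?w) $$ (a, b) = ?w $$ (a, b) + (if a = Suc i then s * ?w $$ (i, b) else 0)"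
      using ab i L by (intro elem_mat_mult GL_carrier) auto
    ultimately show "(?v * ?y s) $$ (a, b) = (?y s * ?w) $$ (a, b)"
      using ab i by (auto simp: last_column_mat_def)
  qed (auto simp: last_column_mat_def)
  have at_ones: "f (?v * ?y s) = (1 - s) powi (lam (i + 2) - \<nu> (i + 2)) * f ?v" if "s \<noteq> 1" for s
  proof -
    have "f (?v * ?y s) = f (last_column_mat n ((\<lambda>_. 1)(Suc i := (1 - s) * 1)))"
      unfolding shift using elem_mat_lower_borel(1)[of i "Suc i" n s] elem_mat_lower_borel(2)[of i "Suc i" n lam s] costandardD(2)[OF f _ L] i by auto
    also have "\<dots> = (1 - s) powi (lam (i + 2) - \<nu> (i + 2)) * f ?v"
      using scale_last_column[OF f tor, of "Suc i" "1 - s" "\<lambda>_. 1"] i that by auto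
    finally show ?thesis .
  qed
  have lin: "poly [:1, -1:] = (\<lambda>s :: 'k. 1 - s)" by auto
  obtain G where G: "has_expansion (\<lambda>s :: 'k. (1 - s) powi (lam (i + 2) - \<nu> (i + 2))) G"
    "fps_nth G 1 = of_int (lam (i + 2) - \<nu> (i + 2)) * - 1"
    using has_expansion_powi[OF has_expansion_poly[of "[:1, -1 :: 'k:]"], of "lam (i + 2) - \<nu> (i + 2)"]
    unfolding lin by auto
  \<comment> \<open>The reparametrisation is constant, so the whole derivative comes from the factor.\<close>
  have "act (hF n (Suc i) (Suc (Suc i)) 1) f ?v = fps_nth G 0 * fps_nth 0 1 *
      act (hF n (Suc i) (Suc (Suc i)) 1) f ?v + fps_nth G 1 * f ?v"
  proof (rule lowering_twist[OF act f _ L L G(1)])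
    show "has_expansion (\<lambda>_ :: 'k. 0) 0" using has_expansion_const[of 0] by simp
    fix s :: 'k assume "poly [:1, -1:] s \<noteq> 0"
    then show "f (?v * ?y s) = (1 - s) powi (lam (i + 2) - \<nu> (i + 2)) * f (?v * ?y 0)"
      using at_ones[of s] by (simp add: y0)
  qed (use i in auto)
  then show ?thesis using G(2) by simp
qed

text \<open>The identity of \<open>SL(2)\<close> that writes an upper times a lower unitriangular matrix as lower times
  diagonal times upper, which is possible if \<open>1 + t s\<close> is invertible.\<close>

lemma upper_lower_factorisation:
  assumes gc: "g \<in> carrier_mat n n" and i: "Suc i < n" and e: "e * (1 + t * s) = (1 :: 'k::field)"
  shows "g * elem_mat n (Suc i) (Suc (Suc i)) t * elem_mat n (Suc (Suc i)) (Suc i) s =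
    g * elem_mat n (Suc (Suc i)) (Suc i) (s * e) * elem_mat n (Suc i) (Suc i) (t * s) *
      elem_mat n (Suc (Suc i)) (Suc (Suc i)) (e - 1) * elem_mat n (Suc i) (Suc (Suc i)) (t * e)"
    (is "?L = ?R")
proof (rule eq_matI)
  fix a b assume "a < dim_row ?R" "b < dim_col ?R"
  then have ab: "a < n" "b < n" using gc by auto
  have ne: "i < n" "Suc i < n" using i by auto
  have e': "e + e * (s * t) = 1" using e by (simp add: algebra_simps)
  let ?c = "g $$ (a, i)" and ?d = "g $$ (a, Suc i)"
  have "?c + s * e * ?d + t * s * (?c + s * e * ?d) = ?c + t * s * ?c + s * ?d * (e + e * (s * t))"
    by (simp add: algebra_simps)
  then have col: "?c + s * (?d + t * ?c) = ?c + s * e * ?d + t * s * (?c + s * e * ?d)"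
    unfolding e' by (simp add: algebra_simps)
  have "?d + (e - 1) * ?d + t * e * (?c + s * e * ?d + t * s * (?c + s * e * ?d)) =
      e * ?d + t * e * (?c + s * (?d + t * ?c))" unfolding col by (simp add: algebra_simps)
  also have "\<dots> = ?d * (e + e * (s * t)) + t * ?c * (e + e * (s * t))" by (simp add: algebra_simps)
  finally have col': "?d + t * ?c =
      ?d + (e - 1) * ?d + t * e * (?c + s * e * ?d + t * s * (?c + s * e * ?d))" unfolding e' by simp
  have "?R $$ (a, b) = (if b = i then ?c + s * e * ?d + t * s * (?c + s * e * ?d)
      else if b = Suc i then ?d + (e - 1) * ?d + t * e * (?c + s * e * ?d + t * s * (?c + s * e * ?d))
      else g $$ (a, b))"
    using ab gc ne by (cases "b = i"; cases "b = Suc i")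
      (simp_all add: mult_elem_mat mult_elem_mat_carrier del: index_mult_mat elem_mat_carrier)
  moreover have "?L $$ (a, b) = (if b = i then ?c + s * (?d + t * ?c)
      else if b = Suc i then ?d + t * ?c else g $$ (a, b))"
    using ab gc ne by (cases "b = i"; cases "b = Suc i")
      (simp_all add: mult_elem_mat mult_elem_mat_carrier del: index_mult_mat elem_mat_carrier)
  ultimately show "?L $$ (a, b) = ?R $$ (a, b)" by (simp only: col col'[symmetric])
qed (use gc in auto)

text \<open>Right translation by \<open>x(t)\<close> commutes with \<open>F\<^sub>i\<close> for the other simple roots; for the root \<open>i\<close> itself the
  diagonal factor \<open>(1 + t s, 1 / (1 + t s))\<close> of \<open>x(t) y(s)\<close> contributes
  \<open>(1 + t s)\<close> to the power \<open>\<nu>\<^sub>i - \<nu>\<^sub>i\<^sub>+\<^sub>1\<close> (indices counted from \<open>1\<close>). This is the group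
  form of the commutator \<open>[E\<^sub>i, F\<^sub>i] = H\<^sub>i - H\<^sub>i\<^sub>+\<^sub>1\<close> and also covers the higher divided powers of \<open>E\<^sub>i\<close>.\<close>

lemma lowering_translate_simple_root:
  fixes act :: "'k::alg_closed_field hyper \<Rightarrow> ('k mat \<Rightarrow> 'k) \<Rightarrow> ('k mat \<Rightarrow> 'k)"
  assumes act: "costandard_action n lam act" and f: "f \<in> costandard n lam" and i: "i + 2 < n"
    and tor: "torus_eigenvector n \<nu> f" and inv: "unipotent_invariant n f"
    and g: "g \<in> GL n" and l: "l + 2 < n"
  shows "act (hF n (Suc i) (Suc (Suc i)) 1) f (g * elem_mat n (Suc l) (Suc (Suc l)) t) =
    act (hF n (Suc i) (Suc (Suc i)) 1) f g +
      (if l = i then of_int (\<nu> (i + 1) - \<nu> (i + 2)) * t * f g else 0)"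
proof -
  let ?y = "elem_mat n (Suc (Suc i)) (Suc i)" and ?x = "elem_mat n (Suc l) (Suc (Suc l))"
  have gc: "g \<in> carrier_mat n n" using g by (rule GL_carrier)
  have x: "h * ?x s \<in> GL n" and y: "h * ?y s \<in> GL n"
    and d: "s \<noteq> - 1 \<Longrightarrow> h * elem_mat n (Suc k) (Suc k) s \<in> GL n" if "h \<in> GL n" "k < n" for h s k
    using that i l by (auto intro!: GL_mult elem_mat_GL)
  have fx: "f (h * ?x s) = f h" if "h \<in> GL n" for h s
    using inv l that unfolding unipotent_invariant_def by simp
  show ?thesis
  proof (cases "l = i")
    case False
    have "act (hF n (Suc i) (Suc (Suc i)) 1) f (g * ?x t) =
        fps_nth (fps_const 1) 0 * fps_nth (fps_of_poly [:0, 1:]) 1 * act (hF n (Suc i) (Suc (Suc i)) 1) f g +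
          fps_nth (fps_const 1) 1 * f g"
    proof (rule lowering_twist[OF act f _ g x[OF g] has_expansion_const has_expansion_poly])
      fix s :: 'k
      have "g * ?x t * ?y s = g * ?y s * ?x t"
      proof (rule eq_matI)
        fix a b assume "a < dim_row (g * ?y s * ?x t)" "b < dim_col (g * ?y s * ?x t)"
        then have ab: "a < n" "b < n" using gc by auto
        have ne: "l \<noteq> i" "i \<noteq> l" "l < n" "i < n" "Suc l < n" "Suc i < n" using i l False by auto
        show "(g * ?x t * ?y s) $$ (a, b) = (g * ?y s * ?x t) $$ (a, b)"
        proof (cases "i = Suc l")
          case True
          show ?thesis using ab gc ne unfolding True by (cases "b = Suc l")
            (simp_all add: mult_elem_mat mult_elem_mat_carrier algebra_simps del: index_mult_mat elem_mat_carrier)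
        next
          case False
          then have "Suc l \<noteq> i" by simp
          with False show ?thesis using ab gc ne by (cases "b = i"; cases "b = Suc l")
            (simp_all add: mult_elem_mat mult_elem_mat_carrier del: index_mult_mat elem_mat_carrier)
        qed
      qed (use gc in auto)
      then show "f (g * ?x t * ?y s) = 1 * f (g * ?y (poly [:0, 1:] s))"
        using fx[OF y[OF g]] i by simp
      show "poly 1 (0 :: 'k) \<noteq> 0" by simp
    qed (use i in auto)
    then show ?thesis using False by simp
  next
    case True
    define e where "e s = inverse (1 + t * s)" for s
    have lin: "poly [:1, t:] = (\<lambda>s. 1 + t * s)" by (auto simp: mult.commute)
    obtain X where X: "has_expansion (\<lambda>s. (1 + t * s) powi (\<nu> (i + 1) - \<nu> (i + 2))) X" "fps_nth X 0 = 1"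
      "fps_nth X 1 = of_int (\<nu> (i + 1) - \<nu> (i + 2)) * t"
      using has_expansion_powi[OF has_expansion_poly[of "[:1, t:]"], of "\<nu> (i + 1) - \<nu> (i + 2)"]
      unfolding lin by auto
    define S where "S = fps_of_poly [:0, 1:] * inverse (fps_of_poly [:1, t:])"
    have "has_expansion (\<lambda>s. poly [:0, 1:] s * inverse (poly [:1, t:] s)) S"
      unfolding S_def by (intro has_expansion_mult has_expansion_inverse has_expansion_poly) simp
    then have S: "has_expansion (\<lambda>s. s * e s) S" by (simp add: e_def mult.commute)
    have S01: "fps_nth S 0 = 0" "fps_nth S 1 = 1" by (simp_all add: S_def fps_mult_nth_1)
    have "act (hF n (Suc i) (Suc (Suc i)) 1) f (g * ?x t) =
        fps_nth X 0 * fps_nth S 1 * act (hF n (Suc i) (Suc (Suc i)) 1) f g + fps_nth X 1 * f g"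
    proof (rule lowering_twist[OF act f _ g x[OF g] X(1) S S01(1)])
      fix s :: 'k assume "poly [:1, t:] s \<noteq> 0"
      then have z: "1 + t * s \<noteq> 0" by (simp add: mult.commute)
      let ?h = "g * ?y (s * e s)"
      let ?d1 = "elem_mat n (Suc i) (Suc i) (t * s)" and ?d' = "elem_mat n (Suc (Suc i)) (Suc (Suc i)) (e s - 1)"
      have "e s * (1 + t * s) = 1" using z by (simp add: e_def)
      then have "g * ?x t * ?y s = ?h * ?d1 * ?d' * ?x (t * e s)"
        using upper_lower_factorisation[OF gc, of i] i True by simp
      moreover have "f (?h * ?d1 * ?d' * ?x (t * e s)) = f (?h * ?d1 * ?d')"
        by (rule fx, intro y d g) (use i z in \<open>auto simp: e_def eq_neg_iff_add_eq_0 add.commute\<close>)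
      moreover have "f (?h * ?d1 * ?d') = e s powi \<nu> (i + 2) * f (?h * ?d1)"
      proof -
        have "?h * ?d1 \<in> GL n" by (intro y d g) (use i z in \<open>auto simp: eq_neg_iff_add_eq_0 add.commute\<close>)
        moreover have "e s - 1 \<noteq> - 1" using z by (simp add: e_def)
        ultimately show ?thesis using tor i unfolding torus_eigenvector_def by simp
      qed
      moreover have "f (?h * ?d1) = (1 + t * s) powi \<nu> (i + 1) * f ?h"
      proof -
        have "?h \<in> GL n" by (intro y g) (use i in auto)
        moreover have "t * s \<noteq> - 1" using z by (auto simp: eq_neg_iff_add_eq_0 add.commute)
        ultimately show ?thesis using tor i unfolding torus_eigenvector_def by simp
      qed
      ultimately show "f (g * ?x t * ?y s) = (1 + t * s) powi (\<nu> (i + 1) - \<nu> (i + 2)) * f ?h"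
        using z by (simp add: e_def power_int_diff power_int_inverse field_simps)
    qed (use i in auto)
    then show ?thesis using True X(2,3) S01(2) by simp
  qed
qed

text \<open>Conjugation by the torus rescales the parameter of \<open>y\<close> by \<open>\<rho>\<close>, which lowers the weight by the simple
  root.\<close>

lemma lowering_torus_eigenvector:
  fixes act :: "'k::alg_closed_field hyper \<Rightarrow> ('k mat \<Rightarrow> 'k) \<Rightarrow> ('k mat \<Rightarrow> 'k)"
  assumes act: "costandard_action n lam act" and f: "f \<in> costandard n lam" and i: "i + 2 < n"
    and tor: "torus_eigenvector n \<nu> f"
  shows "torus_eigenvector n (\<nu>(i + 1 := \<nu> (i + 1) - 1, i + 2 := \<nu> (i + 2) + 1))
    (act (hF n (Suc i) (Suc (Suc i)) 1) f)"
  unfolding torus_eigenvector_def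
proof (intro allI ballI impI)
  fix k and t :: 'k and g :: "'k mat" assume g: "g \<in> GL n" and k: "Suc k < n" and t: "t \<noteq> - 1"
  let ?y = "elem_mat n (Suc (Suc i)) (Suc i)" and ?d = "elem_mat n (Suc k) (Suc k) t"
  have gc: "g \<in> carrier_mat n n" using g by (rule GL_carrier)
  have z: "1 + t \<noteq> 0" using t by (auto simp: eq_neg_iff_add_eq_0 add.commute)
  define \<rho> where "\<rho> = (if k = i then inverse (1 + t) else if k = Suc i then 1 + t else 1)"
  have "act (hF n (Suc i) (Suc (Suc i)) 1) f (g * ?d) =
      fps_nth (fps_const ((1 + t) powi \<nu> (Suc k))) 0 * fps_nth (fps_of_poly [:0, \<rho>:]) 1 *
        act (hF n (Suc i) (Suc (Suc i)) 1) f g + fps_nth (fps_const ((1 + t) powi \<nu> (Suc k))) 1 * f g"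
  proof (rule lowering_twist[OF act f _ g _ has_expansion_const has_expansion_poly])
    show "g * ?d \<in> GL n" using g k t by (intro GL_mult elem_mat_GL) auto
    show "poly 1 (0 :: 'k) \<noteq> 0" by simp
    fix s
    have "g * ?d * ?y s = g * ?y (\<rho> * s) * ?d"
    proof (rule eq_matI)
      fix a b assume "a < dim_row (g * ?y (\<rho> * s) * ?d)" "b < dim_col (g * ?y (\<rho> * s) * ?d)"
      then have ab: "a < n" "b < n" using gc by auto
      have ne: "i < n" "Suc i < n" "k < n" using i k by auto
      have r: "k = i \<Longrightarrow> \<rho> + \<rho> * t = 1" "k = Suc i \<Longrightarrow> \<rho> = 1 + t" "k \<noteq> i \<Longrightarrow> k \<noteq> Suc i \<Longrightarrow> \<rho> = 1"
        using z by (auto simp: \<rho>_def field_simps)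
      have r': "k = i \<Longrightarrow> \<rho> * (s * c) + \<rho> * (s * (t * c)) = s * c" for c
      proof -
        assume "k = i"
        have "\<rho> * (s * c) + \<rho> * (s * (t * c)) = (\<rho> + \<rho> * t) * (s * c)" by (simp add: algebra_simps)
        then show ?thesis using r(1)[OF \<open>k = i\<close>] by simp
      qed
      show "(g * ?d * ?y s) $$ (a, b) = (g * ?y (\<rho> * s) * ?d) $$ (a, b)"
        using ab gc ne r(2,3) by (cases "k = i"; cases "k = Suc i"; cases "b = i"; cases "b = k")
          (simp_all add: mult_elem_mat mult_elem_mat_carrier algebra_simps r' del: index_mult_mat elem_mat_carrier)
    qed (use gc in auto)
    moreover have "g * ?y (\<rho> * s) \<in> GL n" using g i by (intro GL_mult elem_mat_GL) auto
    ultimately show "f (g * ?d * ?y s) = (1 + t) powi \<nu> (Suc k) * f (g * ?y (poly [:0, \<rho>:] s))"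
      using tor k t unfolding torus_eigenvector_def by (simp add: mult.commute)
  qed (use i in auto)
  then have "act (hF n (Suc i) (Suc (Suc i)) 1) f (g * ?d) =
      (1 + t) powi \<nu> (Suc k) * \<rho> * act (hF n (Suc i) (Suc (Suc i)) 1) f g" by simp
  moreover have "(1 + t) powi \<nu> (Suc k) * \<rho> =
      (1 + t) powi (\<nu>(i + 1 := \<nu> (i + 1) - 1, i + 2 := \<nu> (i + 2) + 1)) (Suc k)"
    using z by (auto simp: \<rho>_def power_int_diff power_int_add field_simps)
  ultimately show "act (hF n (Suc i) (Suc (Suc i)) 1) f (g * ?d) =
      (1 + t) powi (\<nu>(i + 1 := \<nu> (i + 1) - 1, i + 2 := \<nu> (i + 2) + 1)) (Suc k) *
        act (hF n (Suc i) (Suc (Suc i)) 1) f g" by simp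
qed

text \<open>Invariance of \<open>F\<^sub>i f\<close> amounts to \<open>\<mu>\<^sub>i = \<mu>\<^sub>i\<^sub>+\<^sub>1\<close> in the field. An invariant \<open>F\<^sub>i f\<close> is determined by its value at the
  column of ones, so it vanishes exactly if that value does.\<close>

lemma lowering_high_weight_iff:
  fixes act :: "'k::alg_closed_field hyper \<Rightarrow> ('k mat \<Rightarrow> 'k) \<Rightarrow> ('k mat \<Rightarrow> 'k)"
  assumes act: "costandard_action n lam act" and f: "f \<in> costandard n lam" "f \<noteq> (\<lambda>_. 0)"
    and hw: "high_weight_vector n (n - 1) act \<mu> f" and i: "1 \<le> i" "i + 1 < n"
  shows "(act (hF n i (i + 1) 1) f \<noteq> (\<lambda>_. 0) \<and>
      (\<exists>\<nu>. high_weight_vector n (n - 1) act \<nu> (act (hF n i (i + 1) 1) f))) \<longleftrightarrow>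
    (of_int (\<mu> i - \<mu> (i + 1)) = (0 :: 'k) \<and> of_int (lam (i + 1) - \<mu> (i + 1)) \<noteq> (0 :: 'k))"
proof -
  obtain r where r: "i = Suc r" using i(1) by (cases i) auto
  have rn: "r + 2 < n" using i r by simp
  define u where "u = act (hF n (Suc r) (Suc (Suc r)) 1) f"
  have u: "u \<in> costandard n lam" unfolding u_def
    using rn by (intro costandard_actionD(1)[OF act f(1)] hyperalgebra_generators) auto
  have tor: "torus_eigenvector n \<mu> f" and inv: "unipotent_invariant n f"
    using hw high_weight_iff_invariant[OF act f(1)] by auto
  define \<mu>' where "\<mu>' = \<mu>(r + 1 := \<mu> (r + 1) - 1, r + 2 := \<mu> (r + 2) + 1)"
  have utor: "torus_eigenvector n \<mu>' u"
    unfolding u_def \<mu>'_def by (rule lowering_torus_eigenvector[OF act f(1) rn tor])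
  note translate = lowering_translate_simple_root[OF act f(1) rn tor inv, folded u_def]
  have uinv: "unipotent_invariant n u \<longleftrightarrow> of_int (\<mu> i - \<mu> (i + 1)) = (0 :: 'k)"
  proof
    assume U: "unipotent_invariant n u"
    obtain g where g: "g \<in> GL n" "f g \<noteq> 0" using costandard_eqI[OF f(1)] f(2) by blast
    have "u (g * elem_mat n (Suc r) (Suc (Suc r)) 1) = u g"
      using U g rn unfolding unipotent_invariant_def by simp
    then show "of_int (\<mu> i - \<mu> (i + 1)) = (0 :: 'k)" using translate[OF g(1) rn, of 1] g(2) r by simp
  next
    assume "of_int (\<mu> i - \<mu> (i + 1)) = (0 :: 'k)"
    then show "unipotent_invariant n u" unfolding unipotent_invariant_def using translate r by auto
  qed
  have one: "f (last_column_mat n (\<lambda>_. 1)) \<noteq> 0"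
    using vanishes_if_at_ones[OF f(1) inv tor] f(2) by blast
  have at_ones: "u (last_column_mat n (\<lambda>_. 1)) =
      - of_int (lam (i + 1) - \<mu> (i + 1)) * f (last_column_mat n (\<lambda>_. 1))"
    using lowering_at_ones[OF act f(1) rn tor] by (simp add: u_def r)
  have "u \<noteq> (\<lambda>_. 0) \<longleftrightarrow> of_int (lam (i + 1) - \<mu> (i + 1)) \<noteq> (0 :: 'k)" if "unipotent_invariant n u"
  proof -
    have "u = (\<lambda>_. 0) \<longleftrightarrow> u (last_column_mat n (\<lambda>_. 1)) = 0"
      using vanishes_if_at_ones[OF u that utor] by auto
    then show ?thesis using at_ones one by auto
  qed
  moreover have "act (hF n i (i + 1) 1) f = u" by (simp add: u_def r)
  ultimately show ?thesis
    using high_weight_iff_invariant[OF act u] utor uinv by metis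
qed

theorem theorem17:
  fixes n i j p :: nat and lam mu :: "nat \<Rightarrow> int"
    and act :: "'k::alg_closed_field hyper \<Rightarrow> ('k mat \<Rightarrow> 'k) \<Rightarrow> ('k mat \<Rightarrow> 'k)"
    and f_lam f_mu_lam :: "'k mat \<Rightarrow> 'k"
  assumes "p = CHAR('k)" and "p > 0"
    and "n > 1"
    and "dominant n lam" and "dominant (n - 1) mu" and "branches n mu lam"
    and "costandard_action n lam act"
    and "f_lam \<in> costandard n lam" and "f_lam \<noteq> (\<lambda>_. 0)" and "high_weight_vector n n act lam f_lam"
    and "branching_vector n lam mu act f_lam f_mu_lam"
    and "i \<ge> 1" and "1 < j" and "j = i + 1" and "j < n"
  shows "(\<exists>A \<subseteq> {i<..<j}.
            act (lowering_op n i j A) f_mu_lam \<noteq> (\<lambda>_. 0) \<and>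
            (\<exists>\<nu>. high_weight_vector n (n - 1) act \<nu> (act (lowering_op n i j A) f_mu_lam)))
     \<longleftrightarrow>
         (j - 1 \<in> frakB1 p mu i j \<and>
          j - 1 \<notin> frakB2 p mu lam i j \<and>
          (\<exists>\<theta>. \<theta> ` frakB2 p mu lam i (j - 1) \<subseteq> frakC p mu i (j - 1) \<and>
               inj_on \<theta> (frakB2 p mu lam i (j - 1)) \<and>
               weakly_decreasing_on (frakB2 p mu lam i (j - 1)) \<theta>) \<and>
          (\<exists>\<theta>. \<theta> ` frakB2 p mu lam i (j - 1) \<subseteq> frakB1 p mu i (j - 1) \<and>
               inj_on \<theta> (frakB2 p mu lam i (j - 1)) \<and>
               weakly_increasing_on (frakB2 p mu lam i (j - 1)) \<theta>))"
proof -
  have f: "f_mu_lam \<in> costandard n lam" "f_mu_lam \<noteq> (\<lambda>_. 0)" "high_weight_vector n (n - 1) act mu f_mu_lam"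
    using assms(11) unfolding branching_vector_def by auto
  have "(\<exists>A \<subseteq> {i<..<j}. act (lowering_op n i j A) f_mu_lam \<noteq> (\<lambda>_. 0) \<and>
          (\<exists>\<nu>. high_weight_vector n (n - 1) act \<nu> (act (lowering_op n i j A) f_mu_lam))) \<longleftrightarrow>
      (act (hF n i (i + 1) 1) f_mu_lam \<noteq> (\<lambda>_. 0) \<and>
        (\<exists>\<nu>. high_weight_vector n (n - 1) act \<nu> (act (hF n i (i + 1) 1) f_mu_lam)))"
  proof -
    have "{i<..<j} = {}" using assms(14) by auto
    moreover have "lowering_op n i j {} = (hF n i (i + 1) 1 :: 'k hyper)"
      using lowering_op_Suc[of i n] assms(12,14,15) by simp
    ultimately show ?thesis by simp
  qed
  also have "\<dots> \<longleftrightarrow> of_int (mu i - mu (i + 1)) = (0 :: 'k) \<and> of_int (lam (i + 1) - mu (i + 1)) \<noteq> (0 :: 'k)"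
    using assms(12,14,15) by (intro lowering_high_weight_iff[OF assms(7) f]) auto
  \<comment> \<open>By the first equation \<open>\<mu>\<^sub>i\<close> and \<open>\<mu>\<^sub>i\<^sub>+\<^sub>1\<close> are interchangeable in \<open>K\<close>.\<close>
  also have "\<dots> \<longleftrightarrow> of_int (mu i - mu (i + 1)) = (0 :: 'k) \<and> of_int (mu i - lam (i + 1)) \<noteq> (0 :: 'k)"
    by auto
  also have "\<dots> \<longleftrightarrow> int p dvd mu i - mu (i + 1) \<and> \<not> int p dvd mu i - lam (i + 1)"
    unfolding of_int_eq_0_iff_char_dvd assms(1) ..
  also have "\<dots> \<longleftrightarrow> j - 1 \<in> frakB1 p mu i j \<and> j - 1 \<notin> frakB2 p mu lam i j"
    using assms(14) by (auto simp: frakB1_def frakB2_def resB1_def resB2_def mod_eq_0_iff_dvd)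
  finally show ?thesis
    using assms(14) by (simp add: frakB2_def weakly_decreasing_on_def weakly_increasing_on_def)
qed

end
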